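(* Let $H$ be a complex Hilbert space and let $T\in\mathcal{AN}(H)$ be normal with polar decomposition $T=V|T|$. Then there exist a compact normal operator $K\in\mathcal B(H)$, a finite rank normal operator $F\in\mathcal B(H)$ and a real number $\alpha\ge 0$ such that (1) $T=K-F+\alpha V$, with $KF=0$ and $F^*F\le\alpha^2 I$; (2) $K^*K+2\alpha\,\mathrm{Re}(V^*K)\ge 0$; (3) $V,K,F$ commute mutually; (4) if $\alpha>0$, then $V\in\mathcal{AN}(H)$.
   Context: $\mathcal B(H)$ denotes the bounded linear operators on $H$. An operator is positive ($\geq 0$) if it is self-adjoint and $\langle Tx,x\rangle\ge 0$ for all $x$; for self-adjoint $S,T$, $S\le T$ means $T-S\ge 0$. $|T|=(T^*T)^{1/2}$; the polar decomposition $T=V|T|$ is the one with $V$ the unique partial isometry satisfying $N(V)=N(T)$ (null spaces). $\mathrm{Re}(A)=\frac{A+A^*}{2}$. An operator $T\in\mathcal B(H)$ is norm attaining if there is a unit vector $x$ with $\|Tx\|=\|T\|$; it is absolutely norm attaining, written $T\in\mathcal{AN}(H)$, if the restriction $T|_M:M\to H$ is norm attaining for every nonzero closed subspace $M$ of $H$. *)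

theory Defs
  imports "HOL-Analysis.Analysis"
begin

section \<open>Complex Hilbert spaces\<close>

class complex_vector = real_vector +
  fixes scaleC :: "complex \<Rightarrow> 'a \<Rightarrow> 'a"  (infixr "*\<^sub>C" 75)
  assumes scaleC_add_right: "a *\<^sub>C (x + y) = a *\<^sub>C x + a *\<^sub>C y"
    and scaleC_add_left: "(a + b) *\<^sub>C x = a *\<^sub>C x + b *\<^sub>C x"
    and scaleC_scaleC: "a *\<^sub>C b *\<^sub>C x = (a * b) *\<^sub>C x"
    and scaleC_one: "1 *\<^sub>C x = x"
    and scaleR_scaleC: "r *\<^sub>R x = complex_of_real r *\<^sub>C x"

global_interpretation complex_vector:
    vector_space "scaleC :: complex \<Rightarrow> 'a \<Rightarrow> 'a :: complex_vector"
  defines csubspace = complex_vector.subspace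
    and cspan = complex_vector.span
  by unfold_locales (simp_all add: scaleC_add_right scaleC_add_left scaleC_scaleC scaleC_one)

text \<open>
  A complex inner product is linear in its first argument.  Its real part is a real inner
  product; identifying it with the one of \<^class>\<open>real_inner\<close> makes the norm and the topology
  those induced by the complex inner product, \<open>norm x = sqrt (Re (cinner x x))\<close>, and
  supplies positive definiteness.
\<close>

class complex_inner = complex_vector + real_inner +
  fixes cinner :: "'a \<Rightarrow> 'a \<Rightarrow> complex"
  assumes cinner_commute: "cinner x y = cnj (cinner y x)"
    and cinner_add_left: "cinner (x + y) z = cinner x z + cinner y z"
    and cinner_scaleC_left: "cinner (c *\<^sub>C x) y = c * cinner x y"
    and inner_eq_Re_cinner: "inner x y = Re (cinner x y)"

class chilbert_space = complex_inner + complete_space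


section \<open>Bounded operators\<close>

definition bounded_clinear :: "('a::complex_inner \<Rightarrow> 'a) \<Rightarrow> bool" where
  "bounded_clinear T \<longleftrightarrow>
    Vector_Spaces.linear scaleC scaleC T \<and> (\<exists>C. \<forall>x. norm (T x) \<le> C * norm x)"

text \<open>For a bounded operator on a Hilbert space the adjoint exists and is unique.\<close>

definition cadjoint :: "('a::chilbert_space \<Rightarrow> 'a) \<Rightarrow> 'a \<Rightarrow> 'a" where
  "cadjoint T = (THE S. \<forall>x y. cinner (T x) y = cinner x (S y))"

definition self_adjoint_op :: "('a::chilbert_space \<Rightarrow> 'a) \<Rightarrow> bool" where
  "self_adjoint_op T \<longleftrightarrow> bounded_clinear T \<and> cadjoint T = T"

definition normal_op :: "('a::chilbert_space \<Rightarrow> 'a) \<Rightarrow> bool" where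
  "normal_op T \<longleftrightarrow> bounded_clinear T \<and> cadjoint T \<circ> T = T \<circ> cadjoint T"

definition positive_op :: "('a::chilbert_space \<Rightarrow> 'a) \<Rightarrow> bool" where
  "positive_op T \<longleftrightarrow> self_adjoint_op T \<and> (\<forall>x. cinner (T x) x \<in> \<real>\<^sub>\<ge>\<^sub>0)"

definition op_le :: "('a::chilbert_space \<Rightarrow> 'a) \<Rightarrow> ('a \<Rightarrow> 'a) \<Rightarrow> bool" where
  "op_le S T \<longleftrightarrow>
    self_adjoint_op S \<and> self_adjoint_op T \<and> positive_op (\<lambda>x. T x - S x)"

definition op_Re :: "('a::chilbert_space \<Rightarrow> 'a) \<Rightarrow> 'a \<Rightarrow> 'a" where
  "op_Re A = (\<lambda>x. (1 / 2) *\<^sub>R (A x + cadjoint A x))"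

text \<open>A positive operator has exactly one positive square root.\<close>

definition op_sqrt :: "('a::chilbert_space \<Rightarrow> 'a) \<Rightarrow> 'a \<Rightarrow> 'a" where
  "op_sqrt A = (THE S. positive_op S \<and> S \<circ> S = A)"

definition op_abs :: "('a::chilbert_space \<Rightarrow> 'a) \<Rightarrow> 'a \<Rightarrow> 'a" where
  "op_abs T = op_sqrt (cadjoint T \<circ> T)"

definition null_space :: "('a::complex_inner \<Rightarrow> 'a) \<Rightarrow> 'a set" where
  "null_space T = {x. T x = 0}"

text \<open>A partial isometry is isometric on the orthogonal complement of its null space.\<close>

definition partial_isometry :: "('a::complex_inner \<Rightarrow> 'a) \<Rightarrow> bool" where
  "partial_isometry V \<longleftrightarrow> bounded_clinear V \<and>
    (\<forall>x. (\<forall>y\<in>null_space V. cinner x y = 0) \<longrightarrow> norm (V x) = norm x)"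

definition polar_decomposition :: "('a::chilbert_space \<Rightarrow> 'a) \<Rightarrow> ('a \<Rightarrow> 'a) \<Rightarrow> bool" where
  "polar_decomposition T V \<longleftrightarrow>
    partial_isometry V \<and> T = V \<circ> op_abs T \<and> null_space V = null_space T"

definition compact_op :: "('a::complex_inner \<Rightarrow> 'a) \<Rightarrow> bool" where
  "compact_op K \<longleftrightarrow> bounded_clinear K \<and> compact (closure (K ` cball 0 1))"

definition finite_rank_op :: "('a::complex_inner \<Rightarrow> 'a) \<Rightarrow> bool" where
  "finite_rank_op F \<longleftrightarrow> bounded_clinear F \<and> (\<exists>B. finite B \<and> range F = cspan B)"


section \<open>Absolutely norm attaining operators\<close>

text \<open>
  The operator norm of the restriction of \<open>T\<close> to a subspace \<open>M\<close>; for \<open>M = UNIV\<close> this is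
  literally \<^const>\<open>onorm\<close>.  The quotient is \<open>0\<close> at \<open>x = 0\<close>.
\<close>

definition onorm_on :: "'a::complex_inner set \<Rightarrow> ('a \<Rightarrow> 'a) \<Rightarrow> real" where
  "onorm_on M T = (SUP x\<in>M. norm (T x) / norm x)"

definition norm_attaining_on :: "'a::complex_inner set \<Rightarrow> ('a \<Rightarrow> 'a) \<Rightarrow> bool" where
  "norm_attaining_on M T \<longleftrightarrow> (\<exists>x\<in>M. norm x = 1 \<and> norm (T x) = onorm_on M T)"

definition absolutely_norm_attaining :: "('a::complex_inner \<Rightarrow> 'a) \<Rightarrow> bool" where
  "absolutely_norm_attaining T \<longleftrightarrow> bounded_clinear T \<and>
    (\<forall>M. csubspace M \<and> closed M \<and> M \<noteq> {0} \<longrightarrow> norm_attaining_on M T)"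

end

theory Submission
  imports Defs
begin

text \<open>
  Put \<open>A = T* T\<close>.  On a closed subspace that is invariant under \<open>A\<close>, a unit vector maximizing
  \<open>norm (T x)\<close> is an eigenvector of \<open>A\<close>; hence the eigenspaces of \<open>A\<close> are total and bounded
  functions of \<open>A\<close> make sense.  There is no orthonormal sequence \<open>g\<close> with pairwise orthogonal images
  under \<open>T\<close> for which \<open>norm (T (g n))\<close> stays strictly below its limit, because \<open>T\<close> would not
  attain its norm on the closed span of \<open>g\<close>.  It follows that for a suitable \<open>\<alpha> \<ge> 0\<close> the spectral
  subspaces of \<open>A\<close> below \<open>\<alpha>\<^sup>2\<close> and above any \<open>s > \<alpha>\<^sup>2\<close> are finite-dimensional.  So the positive
  part of \<open>|T| - \<alpha>\<close> is compact and its negative part has finite rank; composing them with \<open>V\<close>,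
  which preserves the eigenspaces of \<open>A\<close>, gives \<open>K\<close> and \<open>F\<close>.
\<close>

text \<open>Norm attainment on every closed subspace replaces the spectral theorem: it produces
  eigenvectors directly, so operator identities need only be checked on eigenvectors of
  \<open>A\<close>. The polar factor \<open>V\<close> is not a function of \<open>A\<close>;
  normality makes \<open>T\<close> and its adjoint preserve each eigenspace, hence also
  \<open>V\<close> and its adjoint, and so \<open>V\<close> commutes with functions of
  \<open>A\<close>. The number \<alpha>^2 is the infimum of the nonnegative levels above which only
  finitely many dimensions remain. The asymmetry between \<open>K\<close> and \<open>F\<close>
  reflects the forbidden sequences: eigenvalues may decrease to \<alpha>^2 but not increase to it.
  The eigenvalue \<alpha>^2 itself may have infinite multiplicity, which is harmless because |T| -
  \<alpha> vanishes there. Infinite dimension below \<alpha>^2 would mean either eigenvalues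
  increasing to \<alpha>^2, or infinitely many dimensions below some t < \<alpha>^2; in the latter
  case, mixing with eigenvectors above a level between t and \<alpha>^2 simulates such an increase.
  For \<alpha> > 0 the kernel of \<open>T\<close> lies below the threshold, so \<open>V\<close> is
  isometric on a subspace of finite codimension.\<close>

lemma linear_coeff_eq_0_if_quadratic_nonneg:
  fixes a b :: real
  assumes "\<And>t. 2 * t * a + t\<^sup>2 * b \<ge> 0"
  shows "a = 0"
proof (rule ccontr)
  assume "a \<noteq> 0"
  \<comment> \<open>With t = -a/c the quadratic equals (a/c)^2 (b - 2c), so any positive c > b/2
    gives a contradiction; this choice works for every sign of b.\<close>
  define c where "c = 1 + \<bar>b\<bar>"
  have c: "c > 0" "b < 2 * c"
    unfolding c_def by auto
  have "2 * (- a / c) * a + (- a / c)\<^sup>2 * b = (a\<^sup>2 / c\<^sup>2) * (b - 2 * c)"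
    using c by (simp add: field_simps power2_eq_square)
  also have "\<dots> < 0"
    using c \<open>a \<noteq> 0\<close> by (intro mult_pos_neg) auto
  finally show False
    using assms[of "- a / c"] by linarith
qed

lemma power2_norm_add_scaleR:
  fixes u v :: "'a::real_inner"
  shows "(norm (u + t *\<^sub>R v))\<^sup>2 = (norm u)\<^sup>2 + 2 * t * inner u v + t\<^sup>2 * (norm v)\<^sup>2"
  unfolding power2_norm_eq_inner by (simp add: inner_add_left inner_add_right inner_commute power2_eq_square)

section \<open>Real Hilbert spaces\<close>

text \<open>A minimizing sequence for the distance is Cauchy by the parallelogram law, and the
  first-order condition at its limit is orthogonality.\<close>

lemma orthogonal_projection_exists:
  fixes M :: "'a::{real_inner, complete_space} set"
  assumes sub: "subspace M" and cl: "closed M"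
  obtains y where "y \<in> M" "\<And>z. z \<in> M \<Longrightarrow> inner (x - y) z = 0"
proof -
  define d where "d = infdist x M"
  have ne: "M \<noteq> {}"
    using subspace_0[OF sub] by blast
  have d_le: "d \<le> norm (x - z)" if "z \<in> M" for z
    using infdist_le[OF that, of x] by (simp add: d_def dist_norm)
  have d0: "0 \<le> d"
    by (simp add: d_def infdist_nonneg)
  have "\<exists>y\<in>M. (norm (x - y))\<^sup>2 < d\<^sup>2 + 1 / real (Suc n)" for n
  proof -
    have "d < sqrt (d\<^sup>2 + 1 / real (Suc n))"
      using d0 by (intro real_less_rsqrt) simp
    then obtain y where "y \<in> M" "dist x y < sqrt (d\<^sup>2 + 1 / real (Suc n))"
      unfolding d_def infdist_notempty[OF ne]
      using cINF_less_iff[of M "dist x"] ne by auto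
    then show ?thesis
      by (metis dist_norm norm_ge_zero real_less_lsqrt real_sqrt_less_iff real_sqrt_abs abs_of_nonneg)
  qed
  then obtain y where y: "\<And>n. y n \<in> M" "\<And>n. (norm (x - y n))\<^sup>2 < d\<^sup>2 + 1 / real (Suc n)"
    by metis
  have yy: "(norm (y n - y m))\<^sup>2 \<le> 2 / real (Suc n) + 2 / real (Suc m)" for n m
  proof -
    have "(1/2) *\<^sub>R (y n + y m) \<in> M"
      using y(1) sub by (simp add: subspace_add subspace_scale)
    then have "d\<^sup>2 \<le> (norm (x - (1/2) *\<^sub>R (y n + y m)))\<^sup>2"
      using d_le d0 by (intro power_mono)
    \<comment> \<open>Parallelogram law; the midpoint lies in \<open>M\<close>, so its distance to
      \<open>x\<close> is at least \<open>d\<close>.\<close>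
    moreover have "(norm (y n - y m))\<^sup>2 =
       2 * (norm (x - y n))\<^sup>2 + 2 * (norm (x - y m))\<^sup>2 - 4 * (norm (x - (1/2) *\<^sub>R (y n + y m)))\<^sup>2"
      by (simp add: power2_norm_eq_inner algebra_simps inner_commute)
    moreover have "2 / real (Suc n) = 2 * (1 / real (Suc n))" "2 / real (Suc m) = 2 * (1 / real (Suc m))"
      by simp_all
    ultimately show ?thesis
      using y(2)[of n] y(2)[of m] by linarith
  qed
  have "Cauchy y"
  proof (rule metric_CauchyI)
    fix e :: real assume "0 < e"
    then obtain N where N: "4 / e\<^sup>2 < real N"
      using reals_Archimedean2 by blast
    have "dist (y m) (y n) < e" if "m \<ge> N" "n \<ge> N" for m n
    proof -
      have "0 < e\<^sup>2"
        using \<open>0 < e\<close> by simp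
      have *: "2 / real (Suc k) < e\<^sup>2 / 2" if "k \<ge> N" for k
      proof -
        have "4 / e\<^sup>2 < real (Suc k)"
          using N that by linarith
        then show ?thesis
          using \<open>0 < e\<^sup>2\<close> by (simp add: field_simps)
      qed
      have "(norm (y m - y n))\<^sup>2 < e\<^sup>2"
        using yy[of m n] *[OF \<open>m \<ge> N\<close>] *[OF \<open>n \<ge> N\<close>] by linarith
      then show ?thesis
        using \<open>0 < e\<close> by (simp add: dist_norm power_less_imp_less_base)
    qed
    then show "\<exists>N. \<forall>m\<ge>N. \<forall>n\<ge>N. dist (y m) (y n) < e"
      by blast
  qed
  then obtain l where l: "y \<longlonglongrightarrow> l"
    using Cauchy_convergent_iff convergent_def by blast
  have lM: "l \<in> M"
    using closed_sequentially[OF cl _ l] y(1) by blast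
  have "(norm (x - l))\<^sup>2 \<le> d\<^sup>2"
  proof (rule LIMSEQ_le)
    show "(\<lambda>n. (norm (x - y n))\<^sup>2) \<longlonglongrightarrow> (norm (x - l))\<^sup>2"
      by (intro tendsto_intros l)
    have "(\<lambda>n. d\<^sup>2 + 1 / real (Suc n)) \<longlonglongrightarrow> d\<^sup>2 + 0"
      by (intro tendsto_intros LIMSEQ_Suc lim_1_over_n)
    then show "(\<lambda>n. d\<^sup>2 + 1 / real (Suc n)) \<longlonglongrightarrow> d\<^sup>2"
      by simp
    show "\<exists>N. \<forall>n\<ge>N. (norm (x - y n))\<^sup>2 \<le> d\<^sup>2 + 1 / real (Suc n)"
      using y(2) less_imp_le by blast
  qed
  have "inner (x - l) z = 0" if "z \<in> M" for z
  proof -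
    have "2 * t * (- inner (x - l) z) + t\<^sup>2 * (norm z)\<^sup>2 \<ge> 0" for t
    proof -
      have "l + t *\<^sub>R z \<in> M"
        using lM that sub by (simp add: subspace_add subspace_scale)
      then have "d\<^sup>2 \<le> (norm (x - (l + t *\<^sub>R z)))\<^sup>2"
        using d_le d0 by (intro power_mono)
      with \<open>(norm (x - l))\<^sup>2 \<le> d\<^sup>2\<close>
      have "(norm (x - l))\<^sup>2 \<le> (norm (x - (l + t *\<^sub>R z)))\<^sup>2"
        by linarith
      moreover have "(norm (x - (l + t *\<^sub>R z)))\<^sup>2
          = (norm (x - l))\<^sup>2 + 2 * t * (- inner (x - l) z) + t\<^sup>2 * (norm z)\<^sup>2"
        using power2_norm_add_scaleR[of "x - l" "- t" z] by (simp add: diff_diff_eq)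
      ultimately show ?thesis
        by linarith
    qed
    then show ?thesis
      using linear_coeff_eq_0_if_quadratic_nonneg by fastforce
  qed
  with lM that show thesis
    by blast
qed

lemma subspace_closure:
  fixes S :: "'a::real_normed_vector set"
  assumes S: "subspace S"
  shows "subspace (closure S)"
proof (rule subspaceI)
  show "0 \<in> closure S"
    using subspace_0[OF S] closure_subset by blast
  show "x + y \<in> closure S" if xy: "x \<in> closure S" "y \<in> closure S" for x y
  proof -
    obtain u v where "\<And>n. u n \<in> S" "u \<longlonglongrightarrow> x" "\<And>n. v n \<in> S" "v \<longlonglongrightarrow> y"
      using xy unfolding closure_sequential by metis
    then have "\<And>n. u n + v n \<in> S" "(\<lambda>n. u n + v n) \<longlonglongrightarrow> x + y"
      using S by (auto intro: subspace_add tendsto_add)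
    then show ?thesis
      unfolding closure_sequential by metis
  qed
  show "c *\<^sub>R x \<in> closure S" if "x \<in> closure S" for c x
  proof -
    obtain u where "\<And>n. u n \<in> S" "u \<longlonglongrightarrow> x"
      using \<open>x \<in> closure S\<close> unfolding closure_sequential by metis
    then have "\<And>n. c *\<^sub>R u n \<in> S" "(\<lambda>n. c *\<^sub>R u n) \<longlonglongrightarrow> c *\<^sub>R x"
      using S by (auto intro: subspace_scale tendsto_scaleR)
    then show ?thesis
      unfolding closure_sequential by metis
  qed
qed

lemma closure_span_eq_UNIV_if_total:
  fixes X :: "'a::{real_inner, complete_space} set"
  assumes "\<And>x. (\<And>e. e \<in> X \<Longrightarrow> inner x e = 0) \<Longrightarrow> x = 0"
  shows "closure (span X) = UNIV"
proof -
  have "x \<in> closure (span X)" for x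
  proof -
    obtain y where y: "y \<in> closure (span X)" "\<And>z. z \<in> closure (span X) \<Longrightarrow> inner (x - y) z = 0"
      using orthogonal_projection_exists[OF subspace_closure[OF subspace_span] closed_closure, of X x]
      by blast
    then have "x - y = 0"
      using assms[of "x - y"] closure_subset[of "span X"] span_base by blast
    with y(1) show ?thesis
      by simp
  qed
  then show ?thesis
    by blast
qed

text \<open>The set where \<open>f\<close> and \<open>g\<close> agree is closed and contains the
  span of \<open>X\<close>. Nearly every operator identity below is reduced to eigenvectors by this
  principle.\<close>

lemma bounded_linear_eq_on_total:
  fixes X :: "'a::{real_inner, complete_space} set"
  assumes total: "\<And>x. (\<And>e. e \<in> X \<Longrightarrow> inner x e = 0) \<Longrightarrow> x = 0"
    and f: "bounded_linear f" and g: "bounded_linear g"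
    and eq: "\<And>e. e \<in> X \<Longrightarrow> f e = g e"
  shows "f = g"
proof
  fix x
  have "f y = g y" if "y \<in> span X" for y
    using linear_eq_on_span[OF bounded_linear.linear[OF f] bounded_linear.linear[OF g] eq that]
    by blast
  then have "span X \<subseteq> {x. f x = g x}"
    by blast
  moreover have "closed {x. f x = g x}"
    using f g by (intro closed_Collect_eq) (simp_all add: linear_continuous_on)
  ultimately have "closure (span X) \<subseteq> {x. f x = g x}"
    by (rule closure_minimal)
  moreover have "closure (span X) = UNIV"
    by (rule closure_span_eq_UNIV_if_total) (rule total)
  ultimately show "f x = g x"
    by blast
qed

section \<open>Riesz representation and adjoints\<close>

lemma riesz_representation:
  fixes f :: "'a::{real_inner, complete_space} \<Rightarrow> real"
  assumes f: "bounded_linear f"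
  obtains z where "\<And>x. f x = inner x z"
proof (cases "\<forall>x. f x = 0")
  case True
  then show thesis
    using that[of 0] by simp
next
  case False
  then obtain u where u: "f u \<noteq> 0"
    by blast
  interpret f: bounded_linear f by (rule f)
  have "subspace {x. f x = 0}"
    by (simp add: subspace_def f.add f.scaleR f.zero)
  moreover have "closed {x. f x = 0}"
    using f by (intro closed_Collect_eq) (simp_all add: linear_continuous_on)
  ultimately obtain y where y: "f y = 0" "\<And>z. f z = 0 \<Longrightarrow> inner (u - y) z = 0"
    using orthogonal_projection_exists[of "{x. f x = 0}" u] by auto
  define w where "w = u - y"
  have w: "f w = f u"
    by (simp add: w_def f.diff y)
  then have "w \<noteq> 0"
    using u f.zero by force
  show thesis
  proof
    fix x
    \<comment> \<open>The second argument lies in the kernel of \<open>f\<close>, to which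
      \<open>w\<close> is orthogonal.\<close>
    have "inner w (x - (f x / f w) *\<^sub>R w) = 0"
      unfolding w_def[symmetric] using y(2) u w
      by (simp add: w_def f.diff f.scaleR y)
    then have "inner x w = (f x / f w) * inner w w"
      by (simp add: inner_diff_right inner_commute)
    then show "f x = inner x ((f w / inner w w) *\<^sub>R w)"
      using u w \<open>w \<noteq> 0\<close> by (simp add: field_simps)
  qed
qed

lemma real_adjoint_exists:
  fixes T :: "'a::{real_inner, complete_space} \<Rightarrow> 'a"
  assumes T: "bounded_linear T"
  obtains S where "bounded_linear S" "\<And>x y. inner (T x) y = inner x (S y)"
proof -
  have "\<exists>z. \<forall>x. inner (T x) y = inner x z" for y
  proof -
    have "bounded_linear (\<lambda>x. inner (T x) y)"
      using bounded_linear_compose[OF bounded_linear_inner_left T] .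
    then show ?thesis
      using riesz_representation by metis
  qed
  then obtain S where S: "\<And>x y. inner (T x) y = inner x (S y)"
    by metis
  obtain C where C: "C \<ge> 0" "\<And>x. norm (T x) \<le> norm x * C"
    using bounded_linear.nonneg_bounded[OF T] by blast
  have ext: "u = v" if "\<And>x. inner x u = inner x v" for u v :: 'a
    using that[of "u - v"] by (metis inner_diff_right inner_eq_zero_iff right_minus_eq)
  have "bounded_linear S"
  proof (rule bounded_linear_intro)
    show "S (x + y) = S x + S y" for x y
      by (rule ext) (simp add: inner_add_right flip: S)
    show "S (r *\<^sub>R x) = r *\<^sub>R S x" for r x
      by (rule ext) (simp flip: S)
    show "norm (S x) \<le> norm x * C" for x
    proof -
      have "norm (S x) * norm (S x) = inner (T (S x)) x"
        by (simp add: S flip: power2_norm_eq_inner power2_eq_square)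
      also have "\<dots> \<le> norm (T (S x)) * norm x"
        by (rule norm_cauchy_schwarz)
      also have "\<dots> \<le> norm (S x) * C * norm x"
        by (intro mult_right_mono C) simp
      finally show ?thesis
        using C(1) by (cases "S x = 0") (auto simp: mult.assoc mult.commute)
    qed
  qed
  with S that show thesis
    by blast
qed

text \<open>The quadratic \<open>c^2 * norm (x + t z)^2 - norm (T (x + t z))^2\<close> in t is
  nonnegative and vanishes at t = 0, so its linear coefficient is 0. This is the weak form, tested
  against \<open>M\<close>, of \<open>x\<close> being an eigenvector of the adjoint composed with
  \<open>T\<close>.\<close>

lemma norm_maximal_first_order:
  fixes T :: "'a::real_inner \<Rightarrow> 'b::real_inner"
  assumes T: "bounded_linear T" and M: "subspace M" "x \<in> M" "z \<in> M"
    and bound: "\<And>y. y \<in> M \<Longrightarrow> norm (T y) \<le> c * norm y" and max: "norm (T x) = c * norm x"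
  shows "inner (T x) (T z) = c\<^sup>2 * inner x z"
proof -
  interpret T: bounded_linear T by (rule T)
  have "2 * t * (c\<^sup>2 * inner x z - inner (T x) (T z)) + t\<^sup>2 * (c\<^sup>2 * (norm z)\<^sup>2 - (norm (T z))\<^sup>2) \<ge> 0" for t
  proof -
    have "x + t *\<^sub>R z \<in> M"
      using M by (simp add: subspace_add subspace_scale)
    then have "(norm (T (x + t *\<^sub>R z)))\<^sup>2 \<le> (c * norm (x + t *\<^sub>R z))\<^sup>2"
      by (intro power_mono bound) simp_all
    moreover have "(norm (T x))\<^sup>2 = c\<^sup>2 * (norm x)\<^sup>2"
      by (simp add: max power_mult_distrib)
    ultimately show ?thesis
      by (simp add: power_mult_distrib T.add T.scaleR power2_norm_add_scaleR algebra_simps)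
  qed
  then have "c\<^sup>2 * inner x z - inner (T x) (T z) = 0"
    by (rule linear_coeff_eq_0_if_quadratic_nonneg)
  then show ?thesis
    by simp
qed

section \<open>Operators that are diagonal on an orthogonal family of subspaces\<close>

text \<open>Every real is an index, with \<open>E l = {0}\<close> off the eigenvalues. Thus no
  separate set of eigenvalues has to be carried along.\<close>

locale spectral_family =
  fixes E :: "real \<Rightarrow> 'a::{real_inner, complete_space} set"
  assumes subspace_E: "subspace (E l)"
    and orthogonal_E: "l \<noteq> m \<Longrightarrow> e \<in> E l \<Longrightarrow> f \<in> E m \<Longrightarrow> inner e f = 0"
    and total_E: "(\<And>l e. e \<in> E l \<Longrightarrow> inner x e = 0) \<Longrightarrow> x = 0"
begin

lemma ext_E:
  assumes "bounded_linear f" "bounded_linear g" "\<And>l e. e \<in> E l \<Longrightarrow> f e = g e"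
  shows "f = g"
proof (rule bounded_linear_eq_on_total[of "\<Union>l. E l", OF _ assms(1,2)])
  show "x = 0" if "\<And>e. e \<in> (\<Union>l. E l) \<Longrightarrow> inner x e = 0" for x
    using that by (intro total_E) blast
  show "f e = g e" if "e \<in> (\<Union>l. E l)" for e
    using assms(3) that by blast
qed

lemma inner_ext_E:
  assumes "\<And>l e. e \<in> E l \<Longrightarrow> inner x e = inner y e"
  shows "x = y"
  using total_E[of "x - y"] assms by (simp add: inner_diff_left)

lemma span_E_decomposition:
  assumes "x \<in> span (\<Union>l. E l)"
  obtains G v where "finite G" "\<And>l. v l \<in> E l" "x = (\<Sum>l\<in>G. v l)"
proof -
  \<comment> \<open>The extra condition that \<open>v\<close> vanishes outside \<open>G\<close>
    allows \<open>G\<close> to be enlarged by \<open>k\<close> without changing the sum.\<close>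
  have "\<exists>G v. finite G \<and> (\<forall>l. v l \<in> E l) \<and> (\<forall>l. l \<notin> G \<longrightarrow> v l = 0) \<and> x = (\<Sum>l\<in>G. v l)"
    using assms
  proof (induction rule: span_induct_alt)
    case base
    then show ?case
      by (intro exI[of _ "{}"] exI[of _ "\<lambda>_. 0"]) (simp add: subspace_0[OF subspace_E])
  next
    case (step c e y)
    then obtain k G v where *: "e \<in> E k" "finite G" "\<And>l. v l \<in> E l"
        "\<And>l. l \<notin> G \<Longrightarrow> v l = 0" "y = (\<Sum>l\<in>G. v l)"
      by blast
    define w where "w = v(k := v k + c *\<^sub>R e)"
    have "y = (\<Sum>l\<in>insert k G. v l)"
      using * by (cases "k \<in> G") (simp_all add: insert_absorb)
    moreover have "(\<Sum>l\<in>insert k G. w l) = (\<Sum>l\<in>insert k G. v l) + c *\<^sub>R e"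
    proof -
      have "(\<Sum>l\<in>insert k G. w l) = (\<Sum>l\<in>insert k G. v l + (if l = k then c *\<^sub>R e else 0))"
        by (rule sum.cong) (auto simp: w_def)
      then show ?thesis
        using * by (simp add: sum.distrib)
    qed
    moreover have "w l \<in> E l" for l
      using * subspace_add[OF subspace_E] subspace_scale[OF subspace_E] by (simp add: w_def)
    moreover have "w l = 0" if "l \<notin> insert k G" for l
      using * that by (simp add: w_def)
    ultimately show ?case
      using * by (intro exI[of _ "insert k G"] exI[of _ w]) (auto simp: add.commute)
  qed
  with that show thesis
    by blast
qed

text \<open>The bound is imposed only where the eigenspace is nontrivial, so that
  \<open>sqrt\<close> qualifies when the eigenvalues are bounded.\<close>

definition bounded_symbol :: "(real \<Rightarrow> real) \<Rightarrow> real \<Rightarrow> bool" where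
  "bounded_symbol \<phi> C \<longleftrightarrow> C \<ge> 0 \<and> (\<forall>l. E l \<noteq> {0} \<longrightarrow> \<bar>\<phi> l\<bar> \<le> C)"

text \<open>This is \<phi>(A) in weak form: it is determined by its coefficients against
  eigenvectors, which avoids sums over infinitely many eigenspaces. Totality gives uniqueness, and
  boundedness of the symbol gives existence.\<close>

definition diag_op :: "(real \<Rightarrow> real) \<Rightarrow> 'a \<Rightarrow> 'a" where
  "diag_op \<phi> x = (THE y. \<forall>l. \<forall>e\<in>E l. inner y e = \<phi> l * inner x e)"

lemma diag_op_eqI:
  assumes "\<And>l e. e \<in> E l \<Longrightarrow> inner y e = \<phi> l * inner x e"
  shows "diag_op \<phi> x = y"
  unfolding diag_op_def
  by (rule the_equality) (use assms in \<open>auto intro!: inner_ext_E\<close>)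

lemma diag_op_span:
  assumes \<phi>: "bounded_symbol \<phi> C" and x: "x \<in> span (\<Union>l. E l)"
  obtains y where "\<And>l e. e \<in> E l \<Longrightarrow> inner y e = \<phi> l * inner x e" "norm y \<le> C * norm x"
proof -
  obtain G v where *: "finite G" "\<And>l. v l \<in> E l" "x = (\<Sum>l\<in>G. v l)"
    using span_E_decomposition[OF x] by metis
  have pairwise: "inner (v l) (v m) = 0" if "l \<noteq> m" for l m
    using * orthogonal_E[OF that] by blast
  have norm: "(norm (\<Sum>l\<in>G. \<psi> l *\<^sub>R v l))\<^sup>2 = (\<Sum>l\<in>G. (\<psi> l)\<^sup>2 * (norm (v l))\<^sup>2)" for \<psi> :: "real \<Rightarrow> real"
  proof -
    have "(norm (\<Sum>l\<in>G. \<psi> l *\<^sub>R v l))\<^sup>2 = (\<Sum>l\<in>G. (norm (\<psi> l *\<^sub>R v l))\<^sup>2)"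
      using * pairwise by (intro norm_sum_Pythagorean) (auto simp: pairwise_def orthogonal_def)
    then show ?thesis
      by (simp add: power_mult_distrib)
  qed
  define y where "y = (\<Sum>l\<in>G. \<phi> l *\<^sub>R v l)"
  have "inner y e = \<phi> k * inner x e" if "e \<in> E k" for k e
  proof -
    have "inner y e = (\<Sum>l\<in>G. \<phi> l * inner (v l) e)"
      by (simp add: y_def inner_sum_left)
    also have "\<dots> = (\<Sum>l\<in>G. \<phi> k * inner (v l) e)"
    proof (rule sum.cong)
      show "\<phi> l * inner (v l) e = \<phi> k * inner (v l) e" for l
        using orthogonal_E[of l k "v l" e] *(2) that by (cases "l = k") auto
    qed simp
    finally show ?thesis
      by (simp add: *(3) inner_sum_left sum_distrib_left)
  qed
  moreover have "norm y \<le> C * norm x"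
  proof -
    have "(norm y)\<^sup>2 = (\<Sum>l\<in>G. (\<phi> l)\<^sup>2 * (norm (v l))\<^sup>2)"
      by (simp add: y_def norm)
    also have "\<dots> \<le> (\<Sum>l\<in>G. C\<^sup>2 * (norm (v l))\<^sup>2)"
    proof (rule sum_mono)
      fix l
      show "(\<phi> l)\<^sup>2 * (norm (v l))\<^sup>2 \<le> C\<^sup>2 * (norm (v l))\<^sup>2"
      proof (cases "v l = 0")
        case False
        then have "\<bar>\<phi> l\<bar> \<le> C"
          using \<phi> *(2)[of l] by (auto simp: bounded_symbol_def)
        then show ?thesis
          by (intro mult_right_mono) (auto simp: abs_le_square_iff[symmetric])
      qed simp
    qed
    also have "\<dots> = C\<^sup>2 * (norm x)\<^sup>2"
      using norm[of "\<lambda>_. 1"] *(3) by (simp add: sum_distrib_left)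
    finally have "(norm y)\<^sup>2 \<le> (C * norm x)\<^sup>2"
      by (simp add: power_mult_distrib)
    then show ?thesis
      using \<phi> by (auto simp: bounded_symbol_def intro: power2_le_imp_le)
  qed
  ultimately show thesis
    using that by blast
qed

text \<open>Extension by density: the norm estimate on the algebraic span turns a sequence
  converging to \<open>x\<close> into a Cauchy sequence of images.\<close>

lemma diag_op_exists:
  assumes \<phi>: "bounded_symbol \<phi> C"
  obtains y where "\<And>l e. e \<in> E l \<Longrightarrow> inner y e = \<phi> l * inner x e" "norm y \<le> C * norm x"
proof -
  let ?S = "span (\<Union>l. E l)"
  have "closure ?S = UNIV"
    by (rule closure_span_eq_UNIV_if_total) (rule total_E, blast)
  then obtain u where u: "\<And>n. u n \<in> ?S" "u \<longlonglongrightarrow> x"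
    using closure_sequential[of x ?S] by auto
  have "\<exists>y. (\<forall>l. \<forall>e\<in>E l. inner y e = \<phi> l * inner (u n) e) \<and> norm y \<le> C * norm (u n)" for n
    using diag_op_span[OF \<phi> u(1)] by metis
  then obtain y where y: "\<And>n l e. e \<in> E l \<Longrightarrow> inner (y n) e = \<phi> l * inner (u n) e"
      and yn: "\<And>n. norm (y n) \<le> C * norm (u n)"
    by metis
  have diff: "norm (y n - y m) \<le> C * norm (u n - u m)" for n m
  proof -
    have "u n - u m \<in> ?S"
      using u(1) by (simp add: span_diff)
    then obtain z where z: "\<And>l e. e \<in> E l \<Longrightarrow> inner z e = \<phi> l * inner (u n - u m) e"
        "norm z \<le> C * norm (u n - u m)"
      using diag_op_span[OF \<phi>] by metis
    \<comment> \<open>The images were chosen separately for each \<open>u n\<close>; uniqueness of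
      the coefficients identifies their difference with the image of \<open>u n - u m\<close>, to
      which the estimate applies.\<close>
    have "y n - y m = z"
      by (rule inner_ext_E) (simp add: y z inner_diff_left right_diff_distrib)
    with z(2) show ?thesis
      by simp
  qed
  have C: "C \<ge> 0"
    using \<phi> by (simp add: bounded_symbol_def)
  have "Cauchy y"
  proof (rule metric_CauchyI)
    fix e :: real assume "0 < e"
    then have "0 < e / (C + 1)"
      using C by simp
    then obtain N where N: "\<And>m n. m \<ge> N \<Longrightarrow> n \<ge> N \<Longrightarrow> dist (u m) (u n) < e / (C + 1)"
      using LIMSEQ_imp_Cauchy[OF u(2)] unfolding Cauchy_def by meson
    have "dist (y m) (y n) < e" if "m \<ge> N" "n \<ge> N" for m n
    proof -
      have "dist (y m) (y n) \<le> C * dist (u m) (u n)"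
        using diff by (simp add: dist_norm)
      also have "\<dots> \<le> C * (e / (C + 1))"
        using N[OF that] C by (intro mult_left_mono) auto
      also have "\<dots> < e"
        using C \<open>0 < e\<close> by (simp add: field_simps)
      finally show ?thesis .
    qed
    then show "\<exists>N. \<forall>m\<ge>N. \<forall>n\<ge>N. dist (y m) (y n) < e"
      by blast
  qed
  then obtain l where l: "y \<longlonglongrightarrow> l"
    using Cauchy_convergent_iff convergent_def by blast
  show thesis
  proof (rule that)
    show "inner l e = \<phi> k * inner x e" if "e \<in> E k" for k e
    proof (rule LIMSEQ_unique)
      show "(\<lambda>n. inner (y n) e) \<longlonglongrightarrow> inner l e"
        by (intro tendsto_intros l)
      show "(\<lambda>n. inner (y n) e) \<longlonglongrightarrow> \<phi> k * inner x e"
        unfolding y[OF that] by (intro tendsto_intros u)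
    qed
    show "norm l \<le> C * norm x"
    proof (rule LIMSEQ_le)
      show "(\<lambda>n. norm (y n)) \<longlonglongrightarrow> norm l" "(\<lambda>n. C * norm (u n)) \<longlonglongrightarrow> C * norm x"
        by (intro tendsto_intros l u)+
    qed (use yn in blast)
  qed
qed

lemma
  assumes "bounded_symbol \<phi> C"
  shows inner_diag_op: "e \<in> E l \<Longrightarrow> inner (diag_op \<phi> x) e = \<phi> l * inner x e"
    and norm_diag_op: "norm (diag_op \<phi> x) \<le> C * norm x"
proof -
  obtain y where y: "\<And>l e. e \<in> E l \<Longrightarrow> inner y e = \<phi> l * inner x e" "norm y \<le> C * norm x"
    using diag_op_exists[OF assms] by metis
  moreover have "diag_op \<phi> x = y"
    by (rule diag_op_eqI) (rule y)
  ultimately show "e \<in> E l \<Longrightarrow> inner (diag_op \<phi> x) e = \<phi> l * inner x e"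
      "norm (diag_op \<phi> x) \<le> C * norm x"
    by blast+
qed

lemma diag_op_E: "e \<in> E l \<Longrightarrow> diag_op \<phi> e = \<phi> l *\<^sub>R e"
  by (rule diag_op_eqI) (metis inner_scaleR_left mult_zero_right orthogonal_E)

lemma bounded_linear_diag_op:
  assumes \<phi>: "bounded_symbol \<phi> C"
  shows "bounded_linear (diag_op \<phi>)"
proof (rule bounded_linear_intro)
  show "diag_op \<phi> (x + y) = diag_op \<phi> x + diag_op \<phi> y" for x y
    by (rule diag_op_eqI) (simp add: inner_diag_op[OF \<phi>] inner_add_left distrib_left)
  show "diag_op \<phi> (r *\<^sub>R x) = r *\<^sub>R diag_op \<phi> x" for r x
    by (rule diag_op_eqI) (simp add: inner_diag_op[OF \<phi>])
  show "norm (diag_op \<phi> x) \<le> norm x * C" for x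
    using norm_diag_op[OF \<phi>] by (simp add: mult.commute)
qed

text \<open>For fixed \<open>x\<close> both sides are bounded linear in \<open>y\<close> and agree
  on eigenvectors.\<close>

lemma diag_op_symmetric:
  assumes \<phi>: "bounded_symbol \<phi> C"
  shows "inner (diag_op \<phi> x) y = inner x (diag_op \<phi> y)"
proof -
  have "(\<lambda>y. inner (diag_op \<phi> x) y) = (\<lambda>y. inner x (diag_op \<phi> y))"
  proof (rule ext_E)
    show "bounded_linear (\<lambda>y. inner x (diag_op \<phi> y))"
      using bounded_linear_compose[OF bounded_linear_inner_right bounded_linear_diag_op[OF \<phi>]] .
  qed (simp_all add: bounded_linear_inner_right inner_diag_op[OF \<phi>] diag_op_E)
  then show ?thesis
    by meson
qed

lemma diag_op_eq:
  assumes "bounded_symbol \<phi> C" "bounded_linear f" "\<And>l e. e \<in> E l \<Longrightarrow> f e = \<phi> l *\<^sub>R e"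
  shows "f = diag_op \<phi>"
  using assms by (intro ext_E) (auto simp: bounded_linear_diag_op diag_op_E)

text \<open>The square root \<psi> of the symbol gives a symmetric square root of the operator, so
  the inner product is the squared norm of \<open>diag_op \<psi> x\<close>.\<close>

lemma inner_diag_op_nonneg:
  assumes \<phi>: "bounded_symbol \<phi> C" and nonneg: "\<And>l. E l \<noteq> {0} \<Longrightarrow> \<phi> l \<ge> 0"
  shows "inner (diag_op \<phi> x) x \<ge> 0"
proof -
  define \<psi> where "\<psi> l = sqrt (max 0 (\<phi> l))" for l
  have \<psi>: "bounded_symbol \<psi> (sqrt C)"
    using \<phi> nonneg by (auto simp: bounded_symbol_def \<psi>_def max_def)
  have "diag_op \<psi> \<circ> diag_op \<psi> = diag_op \<phi>"
  proof (rule diag_op_eq[OF \<phi>])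
    show "bounded_linear (diag_op \<psi> \<circ> diag_op \<psi>)"
      using bounded_linear_compose[OF bounded_linear_diag_op[OF \<psi>] bounded_linear_diag_op[OF \<psi>]]
      by (simp add: comp_def)
    show "(diag_op \<psi> \<circ> diag_op \<psi>) e = \<phi> l *\<^sub>R e" if "e \<in> E l" for l e
    proof (cases "e = 0")
      case True
      then show ?thesis
        using that by (simp add: diag_op_E)
    next
      case False
      then have "\<phi> l \<ge> 0"
        using that nonneg by blast
      then show ?thesis
        using that diag_op_E[OF subspace_scale[OF subspace_E that], of \<psi> "\<psi> l"]
        by (simp add: diag_op_E \<psi>_def)
    qed
  qed
  then have "inner (diag_op \<phi> x) x = inner (diag_op \<psi> x) (diag_op \<psi> x)"
    using diag_op_symmetric[OF \<psi>, of "diag_op \<psi> x" x] by (metis comp_apply)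
  then show ?thesis
    by simp
qed

end

section \<open>The complex inner product\<close>

lemma cinner_add_right: "cinner x (y + z) = cinner x y + cinner x (z :: 'a::complex_inner)"
  by (metis cinner_add_left cinner_commute complex_cnj_add)

lemma cinner_scaleC_right: "cinner x (c *\<^sub>C y) = cnj c * cinner x (y :: 'a::complex_inner)"
  by (metis cinner_commute cinner_scaleC_left complex_cnj_mult)

lemma cinner_scaleR_left: "cinner (r *\<^sub>R x) y = r * cinner x (y :: 'a::complex_inner)"
  by (simp add: scaleR_scaleC cinner_scaleC_left)

lemma cinner_scaleR_right: "cinner x (r *\<^sub>R y) = r * cinner x (y :: 'a::complex_inner)"
  by (simp add: scaleR_scaleC cinner_scaleC_right)

lemma cinner_zero [simp]: "cinner 0 x = 0" "cinner x 0 = 0" for x :: "'a::complex_inner"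
  using cinner_scaleR_left[of 0 0 x] cinner_scaleR_right[of x 0 0] by simp_all

lemma cinner_diff_left: "cinner (x - y) z = cinner x z - cinner y (z :: 'a::complex_inner)"
  by (metis add_diff_cancel cinner_add_left diff_add_cancel)

lemma cinner_diff_right: "cinner z (x - y) = cinner z x - cinner z (y :: 'a::complex_inner)"
  by (metis add_diff_cancel cinner_add_right diff_add_cancel)

lemma cinner_sum_left: "cinner (\<Sum>i\<in>I. f i) x = (\<Sum>i\<in>I. cinner (f i) (x :: 'a::complex_inner))"
  by (induction I rule: infinite_finite_induct) (simp_all add: cinner_add_left)

lemma cinner_self: "cinner x x = complex_of_real ((norm x)\<^sup>2)" for x :: "'a::complex_inner"
proof (rule complex_eqI)
  show "Im (cinner x x) = Im (complex_of_real ((norm x)\<^sup>2))"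
    using cinner_commute[of x x] by (simp add: complex_eq_iff)
  show "Re (cinner x x) = Re (complex_of_real ((norm x)\<^sup>2))"
    by (simp add: power2_norm_eq_inner inner_eq_Re_cinner del: of_real_power)
qed

lemma cinner_self_eq_0_iff [simp]: "cinner x x = 0 \<longleftrightarrow> x = 0" for x :: "'a::complex_inner"
  by (simp add: cinner_self)

text \<open>Since \<open>Re (\<i> * z) = - Im z\<close>, the real inner product recovers the
  imaginary part as well; this carries the real adjoint over to the complex one.\<close>

lemma cinner_eq_inner:
  "cinner x y = complex_of_real (inner x y) - \<i> * complex_of_real (inner (\<i> *\<^sub>C x) y)"
  for x y :: "'a::complex_inner"
  by (simp add: inner_eq_Re_cinner cinner_scaleC_left complex_eq_iff)

lemma cinner_eq_0_if_inner:
  fixes x :: "'a::complex_inner"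
  assumes "inner x z = 0" "inner x (\<i> *\<^sub>C z) = 0"
  shows "cinner x z = 0"
  using assms by (simp add: inner_eq_Re_cinner cinner_scaleC_right complex_eq_iff)

lemma norm_scaleC: "norm (c *\<^sub>C x) = cmod c * norm x" for x :: "'a::complex_inner"
proof -
  have "complex_of_real ((norm (c *\<^sub>C x))\<^sup>2) = complex_of_real ((cmod c * norm x)\<^sup>2)"
    unfolding cinner_self[symmetric] cinner_scaleC_left cinner_scaleC_right
    using complex_norm_square[of c] by (simp add: cinner_self power_mult_distrib mult_ac)
  then show ?thesis
    by (simp only: of_real_eq_iff power2_eq_iff_nonneg norm_ge_zero mult_nonneg_nonneg)
qed

lemma cmod_cinner_le: "cmod (cinner x y) \<le> norm x * norm y" for x y :: "'a::complex_inner"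
proof (cases "cinner x y = 0")
  case False
  \<comment> \<open>The phase that rotates the inner product onto the nonnegative reals, where the
    real Cauchy-Schwarz inequality applies.\<close>
  define c where "c = cnj (cinner x y) / cmod (cinner x y)"
  have "cmod c = 1"
    using False by (simp add: c_def norm_divide)
  have "cinner (c *\<^sub>C x) y = cmod (cinner x y)"
    using False by (simp add: c_def cinner_scaleC_left field_simps complex_norm_square power2_eq_square
        flip: of_real_mult)
      (metis complex_norm_square power2_eq_square mult.commute of_real_mult)
  then have "cmod (cinner x y) = inner (c *\<^sub>C x) y"
    by (simp add: inner_eq_Re_cinner)
  also have "\<dots> \<le> norm (c *\<^sub>C x) * norm y"
    by (rule norm_cauchy_schwarz)
  finally show ?thesis
    by (simp add: norm_scaleC \<open>cmod c = 1\<close>)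
qed simp

lemma bounded_linear_cinner_left: "bounded_linear (\<lambda>x. cinner x (y :: 'a::complex_inner))"
  by (rule bounded_linear_intro[where K = "norm y"])
    (simp_all add: cinner_add_left cinner_scaleR_left cmod_cinner_le scaleR_conv_of_real)

lemma bounded_linear_cinner_right: "bounded_linear (\<lambda>y. cinner (x :: 'a::complex_inner) y)"
  by (rule bounded_linear_intro[where K = "norm x"])
    (use cmod_cinner_le[of x] in \<open>simp_all add: cinner_add_right cinner_scaleR_right
      scaleR_conv_of_real mult.commute[of "norm x"]\<close>)

lemma cinner_ext:
  fixes x y :: "'a::complex_inner"
  assumes "\<And>z. cinner z x = cinner z y"
  shows "x = y"
  using assms[of "x - y"] cinner_diff_right[of "x - y" x y] by simp

lemma bounded_linear_scaleC_left: "bounded_linear (\<lambda>c. c *\<^sub>C (x :: 'a::complex_inner))"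
  by (rule bounded_linear_intro[where K = "norm x"])
    (simp_all add: scaleC_add_left norm_scaleC scaleR_scaleC scaleC_scaleC scaleR_conv_of_real)

lemma bounded_linear_scaleC_right: "bounded_linear (\<lambda>x. c *\<^sub>C (x :: 'a::complex_inner))"
  by (rule bounded_linear_intro[where K = "cmod c"])
    (simp_all add: scaleC_add_right norm_scaleC scaleR_scaleC scaleC_scaleC mult.commute)

lemma csubspace_imp_subspace:
  fixes M :: "'a::complex_vector set"
  assumes "csubspace M"
  shows "subspace M"
  using assms by (simp add: subspace_def complex_vector.subspace_def scaleR_scaleC)

lemma csubspace_closure:
  fixes M :: "'a::complex_inner set"
  assumes M: "csubspace M"
  shows "csubspace (closure M)"
proof (rule complex_vector.subspaceI)
  note sub = subspace_closure[OF csubspace_imp_subspace[OF M]]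
  show "0 \<in> closure M"
    by (rule subspace_0[OF sub])
  show "x + y \<in> closure M" if "x \<in> closure M" "y \<in> closure M" for x y
    using subspace_add[OF sub that] .
  show "c *\<^sub>C x \<in> closure M" if "x \<in> closure M" for c x
  proof -
    obtain u where u: "\<And>n. u n \<in> M" "u \<longlonglongrightarrow> x"
      using \<open>x \<in> closure M\<close> unfolding closure_sequential by metis
    then have "\<And>n. c *\<^sub>C u n \<in> M"
      using M by (simp add: complex_vector.subspace_scale)
    moreover have "(\<lambda>n. c *\<^sub>C u n) \<longlonglongrightarrow> c *\<^sub>C x"
      using bounded_linear.tendsto[OF bounded_linear_scaleC_right u(2)] .
    ultimately show ?thesis
      unfolding closure_sequential by metis
  qed
qed

section \<open>Bounded complex linear operators and adjoints\<close>

lemma bounded_clinear_iff: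
  fixes T :: "'a::complex_inner \<Rightarrow> 'a"
  shows "bounded_clinear T \<longleftrightarrow> bounded_linear T \<and> (\<forall>c x. T (c *\<^sub>C x) = c *\<^sub>C T x)"
proof
  assume "bounded_clinear T"
  then have lin: "\<And>x y. T (x + y) = T x + T y" "\<And>c x. T (c *\<^sub>C x) = c *\<^sub>C T x"
    and "\<exists>C. \<forall>x. norm (T x) \<le> C * norm x"
    unfolding bounded_clinear_def Vector_Spaces.linear_iff by auto
  then obtain C where "\<And>x. norm (T x) \<le> norm x * C"
    by (metis mult.commute)
  with lin show "bounded_linear T \<and> (\<forall>c x. T (c *\<^sub>C x) = c *\<^sub>C T x)"
    by (auto intro!: bounded_linear_intro simp: scaleR_scaleC)
next
  assume T: "bounded_linear T \<and> (\<forall>c x. T (c *\<^sub>C x) = c *\<^sub>C T x)"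
  then obtain C where "\<And>x. norm (T x) \<le> C * norm x"
    by (metis bounded_linear.bounded mult.commute)
  with T show "bounded_clinear T"
    unfolding bounded_clinear_def Vector_Spaces.linear_iff
    by (auto simp: bounded_linear.linear linear_add complex_vector.vector_space_axioms)
qed

lemma bounded_clinear_bounded_linear: "bounded_clinear T \<Longrightarrow> bounded_linear T"
  by (simp add: bounded_clinear_iff)

lemma bounded_clinear_scaleC: "bounded_clinear T \<Longrightarrow> T (c *\<^sub>C x) = c *\<^sub>C T x"
  by (simp add: bounded_clinear_iff)

lemma bounded_clinear_comp: "bounded_clinear S \<Longrightarrow> bounded_clinear T \<Longrightarrow> bounded_clinear (S \<circ> T)"
  by (simp add: bounded_clinear_iff bounded_linear_compose comp_def)

text \<open>\<open>T\<close> commutes with multiplication by \<i>, so the real identity at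
  \<open>\<i> *\<^sub>C x\<close> supplies the imaginary part.\<close>

lemma cinner_adjoint_if_inner_adjoint:
  fixes T S :: "'a::complex_inner \<Rightarrow> 'a"
  assumes T: "bounded_clinear T" and TS: "\<And>x y. inner (T x) y = inner x (S y)"
  shows "cinner (T x) y = cinner x (S y)"
  by (simp add: cinner_eq_inner TS flip: bounded_clinear_scaleC[OF T])

lemma cadjoint_eqI:
  assumes "\<And>x y. cinner (T x) y = cinner x (S y)"
  shows "cadjoint T = S"
  unfolding cadjoint_def
proof (rule the_equality)
  show "S' = S" if "\<forall>x y. cinner (T x) y = cinner x (S' y)" for S'
    using that assms by (intro ext cinner_ext) metis
qed (use assms in blast)

lemma cadjoint:
  fixes T :: "'a::chilbert_space \<Rightarrow> 'a"
  assumes T: "bounded_clinear T"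
  shows cinner_cadjoint: "cinner (T x) y = cinner x (cadjoint T y)"
    and bounded_clinear_cadjoint: "bounded_clinear (cadjoint T)"
proof -
  obtain S where S: "bounded_linear S" "\<And>x y. inner (T x) y = inner x (S y)"
    using real_adjoint_exists[OF bounded_clinear_bounded_linear[OF T]] by metis
  have TS: "cinner (T x) y = cinner x (S y)" for x y
    by (rule cinner_adjoint_if_inner_adjoint[OF T S(2)])
  then have eq: "cadjoint T = S"
    by (rule cadjoint_eqI)
  show "cinner (T x) y = cinner x (cadjoint T y)"
    unfolding eq by (rule TS)
  have "S (c *\<^sub>C x) = c *\<^sub>C S x" for c x
    by (rule cinner_ext) (simp add: cinner_scaleC_right flip: TS)
  with S(1) show "bounded_clinear (cadjoint T)"
    by (simp add: eq bounded_clinear_iff)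
qed

lemma cinner_cadjoint_left:
  fixes T :: "'a::chilbert_space \<Rightarrow> 'a"
  assumes T: "bounded_clinear T"
  shows "cinner (cadjoint T x) y = cinner x (T y)"
  by (metis T cinner_cadjoint cinner_commute)

lemma self_adjoint_opI:
  fixes T :: "'a::chilbert_space \<Rightarrow> 'a"
  assumes "bounded_clinear T" "\<And>x y. inner (T x) y = inner x (T y)"
  shows "self_adjoint_op T"
  using assms cadjoint_eqI[OF cinner_adjoint_if_inner_adjoint[OF assms]]
  by (simp add: self_adjoint_op_def)

lemma cadjoint_comp_self_adjoint:
  fixes V S :: "'a::chilbert_space \<Rightarrow> 'a"
  assumes V: "bounded_clinear V" and S: "self_adjoint_op S"
  shows "cadjoint (V \<circ> S) = S \<circ> cadjoint V"
proof (rule cadjoint_eqI)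
  have "bounded_clinear S" "cadjoint S = S"
    using S by (simp_all add: self_adjoint_op_def)
  then show "cinner ((V \<circ> S) x) y = cinner x ((S \<circ> cadjoint V) y)" for x y
    using cinner_cadjoint[OF V] cinner_cadjoint[of S] by simp
qed

section \<open>Finite-dimensional subspaces\<close>

definition orthonormal_set :: "'a::complex_inner set \<Rightarrow> bool" where
  "orthonormal_set B \<longleftrightarrow>
    (\<forall>b\<in>B. norm b = 1) \<and> (\<forall>b\<in>B. \<forall>c\<in>B. b \<noteq> c \<longrightarrow> cinner b c = 0)"

text \<open>\<open>X\<close> is an arbitrary set because it is later taken to be a union of
  eigenspaces: the orthonormal system then consists of eigenvectors.\<close>

lemma maximal_orthonormal_subset_exists:
  fixes X :: "'a::complex_inner set"
  obtains B where "B \<subseteq> X" "orthonormal_set B"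
    "\<And>x. x \<in> X \<Longrightarrow> (\<And>b. b \<in> B \<Longrightarrow> cinner x b = 0) \<Longrightarrow> norm x \<noteq> 1"
proof -
  let ?A = "{B. B \<subseteq> X \<and> orthonormal_set B}"
  have "\<exists>M\<in>?A. \<forall>Y\<in>?A. M \<subseteq> Y \<longrightarrow> Y = M"
  proof (rule subset_Zorn')
    fix C assume C: "subset.chain ?A C"
    have "cinner b c = 0" if b: "b \<in> B" "B \<in> C" and c: "c \<in> B'" "B' \<in> C" and "b \<noteq> c" for b c B B'
    proof -
      have "B \<subseteq> B' \<or> B' \<subseteq> B"
        using C b(2) c(2) unfolding subset_chain_def by blast
      moreover have "orthonormal_set B" "orthonormal_set B'"
        using C b(2) c(2) by (auto simp: subset.chain_def)
      ultimately show ?thesis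
        using b(1) c(1) \<open>b \<noteq> c\<close> unfolding orthonormal_set_def by blast
    qed
    moreover have "\<forall>B\<in>C. B \<subseteq> X \<and> (\<forall>b\<in>B. norm b = 1)"
      using C by (auto simp: subset.chain_def orthonormal_set_def)
    ultimately show "\<Union>C \<in> ?A"
      unfolding orthonormal_set_def by blast
  qed
  then obtain B where B: "B \<subseteq> X" "orthonormal_set B"
      and max: "\<And>Y. Y \<subseteq> X \<Longrightarrow> orthonormal_set Y \<Longrightarrow> B \<subseteq> Y \<Longrightarrow> Y = B"
    by auto
  have "norm x \<noteq> 1" if x: "x \<in> X" and orth: "\<And>b. b \<in> B \<Longrightarrow> cinner x b = 0" for x
  proof
    assume "norm x = 1"
    have "cinner b x = 0" if "b \<in> B" for b
      using orth[OF that] cinner_commute[of b x] by simp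
    then have "orthonormal_set (insert x B)"
      using B(2) orth \<open>norm x = 1\<close> by (auto simp: orthonormal_set_def)
    then have "x \<in> B"
      using max[of "insert x B"] B(1) x by blast
    then have "cinner x x = 0"
      by (rule orth)
    with \<open>norm x = 1\<close> show False
      by auto
  qed
  with B that show thesis
    by blast
qed

lemma cinner_orthonormal_sum:
  assumes "orthonormal_set B" "finite B" "b \<in> B"
  shows "cinner (\<Sum>a\<in>B. c a *\<^sub>C a) b = c b"
proof -
  have "cinner (\<Sum>a\<in>B. c a *\<^sub>C a) b = (\<Sum>a\<in>B. if a = b then c b else 0)"
    unfolding cinner_sum_left
    by (rule sum.cong) (use assms in \<open>auto simp: orthonormal_set_def cinner_scaleC_left cinner_self\<close>)
  with assms show ?thesis
    by simp
qed

lemma orthonormal_set_independent: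
  assumes B: "orthonormal_set B"
  shows "\<not> complex_vector.dependent B"
proof
  assume "complex_vector.dependent B"
  then obtain A u v where *: "finite A" "A \<subseteq> B" "(\<Sum>a\<in>A. u a *\<^sub>C a) = 0" "v \<in> A" "u v \<noteq> 0"
    unfolding complex_vector.dependent_explicit by blast
  have "orthonormal_set A"
    using B *(2) by (auto simp: orthonormal_set_def)
  then have "cinner (\<Sum>a\<in>A. u a *\<^sub>C a) v = u v"
    using * by (intro cinner_orthonormal_sum)
  with * show False
    by simp
qed

text \<open>The residual lies in \<open>M\<close> and is orthogonal to \<open>B\<close>; normalized,
  it would contradict maximality.\<close>

lemma orthonormal_expansion:
  assumes M: "csubspace M" and B: "B \<subseteq> M" "orthonormal_set B" "finite B"
    and max: "\<And>x. x \<in> M \<Longrightarrow> (\<And>b. b \<in> B \<Longrightarrow> cinner x b = 0) \<Longrightarrow> norm x \<noteq> 1"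
    and x: "x \<in> M"
  shows "x = (\<Sum>b\<in>B. cinner x b *\<^sub>C b)"
proof (rule ccontr)
  define d where "d = x - (\<Sum>b\<in>B. cinner x b *\<^sub>C b)"
  assume "x \<noteq> (\<Sum>b\<in>B. cinner x b *\<^sub>C b)"
  then have "d \<noteq> 0"
    by (simp add: d_def)
  have "d \<in> M"
    unfolding d_def using M x B(1)
    by (intro complex_vector.subspace_diff complex_vector.subspace_sum complex_vector.subspace_scale) auto
  then have "(1 / norm d) *\<^sub>R d \<in> M"
    using csubspace_imp_subspace[OF M] by (simp add: subspace_scale)
  moreover have "cinner ((1 / norm d) *\<^sub>R d) b = 0" if "b \<in> B" for b
    using cinner_orthonormal_sum[OF B(2,3) that]
    by (simp add: d_def cinner_scaleR_left cinner_diff_left)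
  ultimately have "norm ((1 / norm d) *\<^sub>R d) \<noteq> 1"
    by (rule max)
  with \<open>d \<noteq> 0\<close> show False
    by simp
qed

text \<open>By induction, the combinations stay in a sum of images of discs. This provides
  compactness in finite-dimensional subspaces.\<close>

lemma bounded_combinations_in_compact:
  fixes B :: "'a::complex_inner set"
  assumes "finite B"
  obtains C where "compact C"
    "\<And>c. (\<And>b. b \<in> B \<Longrightarrow> cmod (c b) \<le> r) \<Longrightarrow> (\<Sum>b\<in>B. c b *\<^sub>C b) \<in> C"
proof -
  have "\<exists>C. compact C \<and> (\<forall>c. (\<forall>b\<in>B. cmod (c b) \<le> r) \<longrightarrow> (\<Sum>b\<in>B. c b *\<^sub>C b) \<in> C)"
    using assms
  proof induction
    case empty
    show ?case
      by (intro exI[of _ "{0}"]) simp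
  next
    case (insert a B)
    then obtain C where C: "compact C"
        "\<And>c. (\<forall>b\<in>B. cmod (c b) \<le> r) \<Longrightarrow> (\<Sum>b\<in>B. c b *\<^sub>C b) \<in> C"
      by blast
    let ?D = "(\<lambda>c. c *\<^sub>C a) ` cball 0 r"
    have "compact ?D"
      by (intro compact_continuous_image linear_continuous_on bounded_linear_scaleC_left compact_cball)
    then have "compact {x + y |x y. x \<in> ?D \<and> y \<in> C}"
      using C(1) by (rule compact_sums)
    moreover have "(\<Sum>b\<in>insert a B. c b *\<^sub>C b) \<in> {x + y |x y. x \<in> ?D \<and> y \<in> C}"
      if "\<forall>b\<in>insert a B. cmod (c b) \<le> r" for c
    proof -
      have "c a *\<^sub>C a \<in> ?D" "(\<Sum>b\<in>B. c b *\<^sub>C b) \<in> C"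
        using that C(2)[of c] by auto
      with insert.hyps show ?thesis
        by auto
    qed
    ultimately show ?case
      by blast
  qed
  with that show thesis
    by metis
qed

text \<open>The range is a subspace, so it is the span of a maximal independent subset of itself,
  which is finite because it lies in the span of \<open>B\<close>.\<close>

lemma finite_rank_opI:
  fixes F :: "'a::complex_inner \<Rightarrow> 'a"
  assumes F: "bounded_clinear F" and B: "finite B" "range F \<subseteq> cspan B"
  shows "finite_rank_op F"
proof -
  have "csubspace (range F)"
    using F unfolding complex_vector.subspace_def bounded_clinear_iff
    by (auto simp: image_iff) (metis bounded_linear.linear linear_0, metis bounded_linear.linear linear_add, metis)
  obtain A where A: "A \<subseteq> range F" "\<not> complex_vector.dependent A" "range F \<subseteq> cspan A"
    using complex_vector.maximal_independent_subset by metis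
  have "finite A"
    using complex_vector.independent_span_bound[OF B(1) A(2)] A(1) B(2) by blast
  moreover have "cspan A = range F"
    using A \<open>csubspace (range F)\<close> by (metis complex_vector.span_subspace)
  ultimately show ?thesis
    using F unfolding finite_rank_op_def by blast
qed

section \<open>Compact and absolutely norm attaining operators\<close>

text \<open>The image of the unit ball under \<open>K\<close> is uniformly close to its image under
  \<open>G\<close>, which lies in a compact set of bounded combinations of \<open>B\<close>; so it
  is totally bounded.\<close>

lemma compact_op_if_finite_rank_approx:
  fixes K :: "'a::chilbert_space \<Rightarrow> 'a"
  assumes K: "bounded_clinear K"
    and approx: "\<And>\<epsilon>. \<epsilon> > 0 \<Longrightarrow> \<exists>G B. bounded_linear G \<and> finite B \<and> orthonormal_set B \<and>
      (\<forall>x. G x = (\<Sum>b\<in>B. cinner (G x) b *\<^sub>C b)) \<and> (\<forall>x. norm (K x - G x) \<le> \<epsilon> * norm x)"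
  shows "compact_op K"
proof -
  have "compact (closure (K ` cball 0 1))"
    unfolding compact_eq_totally_bounded
  proof (intro conjI allI impI)
    show "complete (closure (K ` cball 0 1))"
      by (simp add: complete_eq_closed)
    fix e :: real assume "0 < e"
    then obtain G B where G: "bounded_linear G" "finite B" "orthonormal_set B"
        "\<And>x. G x = (\<Sum>b\<in>B. cinner (G x) b *\<^sub>C b)" "\<And>x. norm (K x - G x) \<le> (e / 3) * norm x"
      using approx[of "e / 3"] by auto
    obtain r where r: "r \<ge> 0" "\<And>x. norm (G x) \<le> norm x * r"
      using bounded_linear.nonneg_bounded[OF G(1)] by blast
    obtain C where C: "compact C"
        "\<And>c. (\<And>b. b \<in> B \<Longrightarrow> cmod (c b) \<le> r) \<Longrightarrow> (\<Sum>b\<in>B. c b *\<^sub>C b) \<in> C"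
      using bounded_combinations_in_compact[OF G(2)] by metis
    have GC: "G x \<in> C" if "norm x \<le> 1" for x
    proof (subst G(4), rule C(2))
      fix b assume "b \<in> B"
      then have "cmod (cinner (G x) b) \<le> norm (G x)"
        using cmod_cinner_le[of "G x" b] G(3) by (simp add: orthonormal_set_def)
      also have "\<dots> \<le> r"
        using r that mult_right_mono[of "norm x" 1 r] order_trans by fastforce
      finally show "cmod (cinner (G x) b) \<le> r" .
    qed
    obtain k where k: "finite k" "C \<subseteq> (\<Union>x\<in>k. ball x (e / 3))"
      using C(1) \<open>0 < e\<close> unfolding compact_eq_totally_bounded by (meson divide_pos_pos zero_less_numeral)
    \<comment> \<open>One third of \<open>e\<close> comes from the net for \<open>C\<close> and one
      third from the approximation. The remaining third lets closed balls, which survive the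
      closure, be replaced by open ones.\<close>
    have "K ` cball 0 1 \<subseteq> (\<Union>x\<in>k. cball x (2 * e / 3))"
    proof
      fix y assume "y \<in> K ` cball 0 1"
      then obtain x where x: "norm x \<le> 1" "y = K x"
        by auto
      then obtain z where z: "z \<in> k" "dist z (G x) < e / 3"
        using GC[of x] k(2) by auto
      have "dist (G x) (K x) \<le> e / 3 * norm x"
        using G(5)[of x] by (simp add: dist_norm norm_minus_commute)
      also have "\<dots> \<le> e / 3"
        using x(1) \<open>0 < e\<close> mult_left_mono[of "norm x" 1 "e / 3"] by simp
      finally have "dist z y \<le> 2 * e / 3"
        using z(2) x(2) dist_triangle[of z "K x" "G x"] by simp
      with z(1) show "y \<in> (\<Union>x\<in>k. cball x (2 * e / 3))"
        by auto
    qed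
    then have "closure (K ` cball 0 1) \<subseteq> (\<Union>x\<in>k. cball x (2 * e / 3))"
      using k(1) by (intro closure_minimal closed_UN) auto
    also have "\<dots> \<subseteq> (\<Union>x\<in>k. ball x e)"
      using \<open>0 < e\<close> by fastforce
    finally show "\<exists>k. finite k \<and> closure (K ` cball 0 1) \<subseteq> (\<Union>x\<in>k. ball x e)"
      using k(1) by blast
  qed
  with K show ?thesis
    by (simp add: compact_op_def)
qed

lemma compact_op_comp:
  fixes V K :: "'a::complex_inner \<Rightarrow> 'a"
  assumes V: "bounded_clinear V" and K: "compact_op K"
  shows "compact_op (V \<circ> K)"
proof -
  let ?C = "V ` closure (K ` cball 0 1)"
  have C: "compact ?C"
    using K V by (intro compact_continuous_image linear_continuous_on bounded_clinear_bounded_linear)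
      (auto simp: compact_op_def)
  moreover have "closure ((V \<circ> K) ` cball 0 1) \<subseteq> ?C"
    using C closure_subset[of "K ` cball 0 1"]
    by (intro closure_minimal) (auto simp: compact_imp_closed image_iff)
  ultimately have "compact (closure ((V \<circ> K) ` cball 0 1))"
    using compact_closure by (metis compact_eq_bounded_closed bounded_subset closed_closure
        compact_Int_closed inf.absorb_iff2)
  with K V show ?thesis
    by (simp add: compact_op_def bounded_clinear_comp)
qed

text \<open>Replaces the supremum of quotients by a pointwise inequality. The quotient at 0 is 0 by
  convention and does not affect the supremum, as \<open>norm (T x)\<close> is nonnegative.\<close>

lemma norm_attaining_on_iff:
  assumes T: "bounded_clinear T"
  shows "norm_attaining_on M T \<longleftrightarrow>
    (\<exists>x\<in>M. norm x = 1 \<and> (\<forall>y\<in>M. norm (T y) \<le> norm (T x) * norm y))"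
proof -
  have T0: "T 0 = 0"
    using bounded_clinear_bounded_linear[OF T] by (simp add: linear_simps)
  obtain C where C: "C \<ge> 0" "\<And>x. norm (T x) \<le> norm x * C"
    using bounded_linear.nonneg_bounded[OF bounded_clinear_bounded_linear[OF T]] by blast
  have bdd: "bdd_above ((\<lambda>y. norm (T y) / norm y) ` M)"
  proof (rule bdd_aboveI2)
    show "norm (T y) / norm y \<le> C" for y
      using C by (cases "y = 0") (auto simp: field_simps)
  qed
  have "norm (T x) = onorm_on M T \<longleftrightarrow> (\<forall>y\<in>M. norm (T y) \<le> norm (T x) * norm y)"
    if x: "x \<in> M" "norm x = 1" for x
  proof
    assume eq: "norm (T x) = onorm_on M T"
    show "\<forall>y\<in>M. norm (T y) \<le> norm (T x) * norm y"
    proof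
      fix y assume "y \<in> M"
      then have "norm (T y) / norm y \<le> norm (T x)"
        unfolding eq onorm_on_def using bdd by (rule cSUP_upper)
      then show "norm (T y) \<le> norm (T x) * norm y"
        by (cases "y = 0") (auto simp: T0 field_simps)
    qed
  next
    assume *: "\<forall>y\<in>M. norm (T y) \<le> norm (T x) * norm y"
    have "onorm_on M T = norm (T x)"
      unfolding onorm_on_def
    proof (rule cSup_eq_maximum)
      show "norm (T x) \<in> (\<lambda>y. norm (T y) / norm y) ` M"
        using x by (intro image_eqI[of _ _ x]) simp_all
      show "z \<le> norm (T x)" if "z \<in> (\<lambda>y. norm (T y) / norm y) ` M" for z
      proof -
        obtain y where "y \<in> M" "z = norm (T y) / norm y"
          using \<open>z \<in> _\<close> by blast
        with * show ?thesis
          by (cases "y = 0") (auto simp: divide_le_eq)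
      qed
    qed
    then show "norm (T x) = onorm_on M T"
      by simp
  qed
  then show ?thesis
    unfolding norm_attaining_on_def by blast
qed

text \<open>Either \<open>M\<close> contains a unit vector orthogonal to \<open>B\<close>, where the
  contraction \<open>V\<close> attains norm 1, or the projection onto the span of \<open>B\<close>
  has no kernel in \<open>M\<close>; then \<open>M\<close> is finite-dimensional and its unit sphere
  is compact.\<close>

lemma absolutely_norm_attaining_if_isometric_on_finite_codim:
  fixes V :: "'a::complex_inner \<Rightarrow> 'a"
  assumes V: "bounded_clinear V" and contr: "\<And>x. norm (V x) \<le> norm x"
    and B: "finite B" "orthonormal_set B"
    and iso: "\<And>x. (\<And>b. b \<in> B \<Longrightarrow> cinner x b = 0) \<Longrightarrow> norm (V x) = norm x"
  shows "absolutely_norm_attaining V"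
  unfolding absolutely_norm_attaining_def norm_attaining_on_iff[OF V]
proof (intro conjI allI impI V)
  fix M :: "'a set" assume "csubspace M \<and> closed M \<and> M \<noteq> {0}"
  then have M: "csubspace M" "closed M" "M \<noteq> {0}"
    by auto
  show "\<exists>x\<in>M. norm x = 1 \<and> (\<forall>y\<in>M. norm (V y) \<le> norm (V x) * norm y)"
  proof (cases "\<exists>x\<in>M. norm x = 1 \<and> (\<forall>b\<in>B. cinner x b = 0)")
    case True
    then obtain x where "x \<in> M" "norm x = 1" "\<And>b. b \<in> B \<Longrightarrow> cinner x b = 0"
      by blast
    then show ?thesis
      using iso[of x] contr by auto
  next
    case False
    define Q where "Q x = (\<Sum>b\<in>B. cinner x b *\<^sub>C b)" for x
    have Q: "Vector_Spaces.linear scaleC scaleC Q"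
      unfolding Vector_Spaces.linear_iff
      by (simp add: complex_vector.vector_space_axioms Q_def cinner_add_left cinner_scaleC_left
          scaleC_add_left sum.distrib complex_vector.scale_sum_right scaleC_scaleC)
    interpret Q: Vector_Spaces.linear scaleC scaleC Q
      by (rule Q)
    obtain A where A: "A \<subseteq> M" "orthonormal_set A"
        and max: "\<And>x. x \<in> M \<Longrightarrow> (\<And>b. b \<in> A \<Longrightarrow> cinner x b = 0) \<Longrightarrow> norm x \<noteq> 1"
      using maximal_orthonormal_subset_exists by metis
    have span_A: "cspan A \<subseteq> M"
      using A(1) M(1) by (rule complex_vector.span_minimal)
    have inj: "inj_on Q (cspan A)"
    proof -
      have "\<forall>x\<in>cspan A. Q x = 0 \<longrightarrow> x = 0"
      proof (intro ballI impI, rule ccontr)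
        fix x assume x: "x \<in> cspan A" "Q x = 0" "x \<noteq> 0"
        have "cinner x b = 0" if "b \<in> B" for b
          using cinner_orthonormal_sum[OF B(2,1) that, of "cinner x"] x(2) by (simp add: Q_def)
        then have "\<forall>b\<in>B. cinner ((1 / norm x) *\<^sub>R x) b = 0"
          by (simp add: cinner_scaleR_left)
        moreover have "(1 / norm x) *\<^sub>R x \<in> M"
          using x(1) span_A csubspace_imp_subspace[OF M(1)] by (auto intro: subspace_scale)
        moreover have "norm ((1 / norm x) *\<^sub>R x) = 1"
          using x(3) by simp
        ultimately show False
          using False by blast
      qed
      then show ?thesis
        using Q.inj_on_iff_eq_0[folded csubspace_def, OF complex_vector.subspace_span] by blast
    qed
    \<comment> \<open>An injective linear image of the independent set \<open>A\<close> sits in the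
      span of the finite set \<open>B\<close>, which bounds the size of \<open>A\<close>.\<close>
    have "\<not> complex_vector.dependent (Q ` A)"
      using orthonormal_set_independent[OF A(2)] inj by (rule Q.independent_injective_image[folded cspan_def])
    moreover have "Q x \<in> cspan B" for x
      unfolding Q_def
      by (intro complex_vector.span_sum complex_vector.span_scale complex_vector.span_base)
    ultimately have "finite (Q ` A)"
      using complex_vector.independent_span_bound[OF B(1)] by (metis image_subsetI)
    then have "finite A"
      using inj complex_vector.span_superset by (metis finite_image_iff inj_on_subset)
    then obtain C where C: "compact C"
        "\<And>c. (\<And>b. b \<in> A \<Longrightarrow> cmod (c b) \<le> 1) \<Longrightarrow> (\<Sum>b\<in>A. c b *\<^sub>C b) \<in> C"
      using bounded_combinations_in_compact by metis
    let ?S = "M \<inter> sphere 0 1"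
    have "?S \<subseteq> C"
    proof
      fix x assume x: "x \<in> ?S"
      have "(\<Sum>b\<in>A. cinner x b *\<^sub>C b) \<in> C"
      proof (rule C(2))
        show "cmod (cinner x b) \<le> 1" if "b \<in> A" for b
          using x cmod_cinner_le[of x b] A(2) that by (auto simp: orthonormal_set_def)
      qed
      then show "x \<in> C"
        using orthonormal_expansion[OF M(1) A \<open>finite A\<close> max] x by auto
    qed
    then have "?S = C \<inter> ?S"
      by blast
    moreover have "closed ?S"
      using M(2) unfolding sphere_def by (intro closed_Int closed_Collect_eq continuous_intros)
    ultimately have "compact ?S"
      using C(1) by (metis compact_Int_closed)
    moreover have normalize: "(1 / norm y) *\<^sub>R y \<in> ?S" if "y \<in> M" "y \<noteq> 0" for y
      using that csubspace_imp_subspace[OF M(1)] by (simp add: subspace_scale)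
    moreover have "?S \<noteq> {}"
      using normalize M(3) complex_vector.subspace_0[OF M(1)] by blast
    moreover have "continuous_on ?S (\<lambda>x. norm (V x))"
      by (intro continuous_intros linear_continuous_on bounded_clinear_bounded_linear V)
    ultimately obtain x where x: "x \<in> ?S" "\<And>y. y \<in> ?S \<Longrightarrow> norm (V y) \<le> norm (V x)"
      using continuous_attains_sup by metis
    have "norm (V y) \<le> norm (V x) * norm y" if "y \<in> M" for y
    proof (cases "y = 0")
      case True
      then show ?thesis
        using contr[of y] by simp
    next
      case False
      then have "norm (V ((1 / norm y) *\<^sub>R y)) \<le> norm (V x)"
        using normalize that x(2) by blast
      then show ?thesis
        using False V by (simp add: bounded_clinear_iff linear_simps field_simps)
    qed
    with x(1) show ?thesis
      by auto
  qed
qed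

section \<open>The spectrum of an absolutely norm attaining operator\<close>

locale an_operator =
  fixes T :: "'a::chilbert_space \<Rightarrow> 'a"
  assumes AN: "absolutely_norm_attaining T"
begin

lemma bounded_clinear_T: "bounded_clinear T"
  using AN by (simp add: absolutely_norm_attaining_def)

lemmas bounded_linear_T = bounded_clinear_bounded_linear[OF bounded_clinear_T]

definition A :: "'a \<Rightarrow> 'a" where
  "A = cadjoint T \<circ> T"

definition E :: "real \<Rightarrow> 'a set" where
  "E l = {x. A x = l *\<^sub>R x}"

lemma cinner_A: "cinner (A x) y = cinner (T x) (T y)"
  by (simp add: A_def cinner_cadjoint_left[OF bounded_clinear_T])

lemma cinner_A_right: "cinner x (A y) = cinner (T x) (T y)"
  by (simp add: A_def cinner_cadjoint[OF bounded_clinear_T])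

lemma bounded_clinear_A: "bounded_clinear A"
  unfolding A_def by (intro bounded_clinear_comp bounded_clinear_cadjoint bounded_clinear_T)

lemma csubspace_E: "csubspace (E l)"
  using bounded_clinear_A unfolding E_def complex_vector.subspace_def
  by (auto simp: bounded_clinear_iff linear_simps scaleC_add_right scaleR_scaleC scaleC_scaleC mult.commute)

lemma cinner_E_eq_0:
  assumes "l \<noteq> m" "e \<in> E l" "f \<in> E m"
  shows "cinner e f = 0"
proof -
  have "l * cinner e f = cinner (A e) f"
    using assms by (simp add: E_def cinner_scaleR_left)
  also have "\<dots> = m * cinner e f"
    using assms cinner_A[of e f] cinner_A_right[of e f] by (simp add: E_def cinner_scaleR_right)
  finally show ?thesis
    using assms(1) by simp
qed

lemma norm_T_E: "e \<in> E l \<Longrightarrow> (norm (T e))\<^sup>2 = l * (norm e)\<^sup>2"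
proof -
  assume "e \<in> E l"
  then have "complex_of_real ((norm (T e))\<^sup>2) = complex_of_real (l * (norm e)\<^sup>2)"
    unfolding cinner_self[symmetric] of_real_mult by (simp add: E_def cinner_scaleR_left flip: cinner_A)
  then show ?thesis
    by (simp only: of_real_eq_iff)
qed

text \<open>The last property says that \<open>A x - (norm (T x))^2 x\<close> is orthogonal to
  \<open>M\<close>. It is an eigenvector equation once that vector itself lies in
  \<open>M\<close>.\<close>

lemma maximizing_vector_exists:
  assumes M: "csubspace M" "closed M" "M \<noteq> {0}"
  obtains x where "x \<in> M" "norm x = 1" "\<And>y. y \<in> M \<Longrightarrow> norm (T y) \<le> norm (T x) * norm y"
    "\<And>z. z \<in> M \<Longrightarrow> cinner (T x) (T z) = (norm (T x))\<^sup>2 * cinner x z"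
proof -
  obtain x where x: "x \<in> M" "norm x = 1" "\<And>y. y \<in> M \<Longrightarrow> norm (T y) \<le> norm (T x) * norm y"
    using AN M norm_attaining_on_iff[OF bounded_clinear_T, of M]
    unfolding absolutely_norm_attaining_def by blast
  have real: "inner (T x) (T z) = (norm (T x))\<^sup>2 * inner x z" if "z \<in> M" for z
    using norm_maximal_first_order[OF bounded_linear_T csubspace_imp_subspace[OF M(1)] x(1) that x(3)]
      x(2) by simp
  have "cinner (T x) (T z) - (norm (T x))\<^sup>2 * cinner x z = 0" if "z \<in> M" for z
  proof -
    \<comment> \<open>The first-order condition is only real; testing it with both \<open>z\<close>
      and \<open>\<i> *\<^sub>C z\<close>, which lie in the complex subspace \<open>M\<close>, gives
      complex orthogonality.\<close>
    have "cinner (A x - (norm (T x))\<^sup>2 *\<^sub>R x) z = 0"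
    proof (rule cinner_eq_0_if_inner)
      have inner0: "inner (A x - (norm (T x))\<^sup>2 *\<^sub>R x) y = 0" if "y \<in> M" for y
      proof -
        have "inner (A x) y = inner (T x) (T y)"
          by (simp add: inner_eq_Re_cinner cinner_A)
        with real[OF that] show ?thesis
          by (simp add: inner_diff_left)
      qed
      show "inner (A x - (norm (T x))\<^sup>2 *\<^sub>R x) z = 0"
          "inner (A x - (norm (T x))\<^sup>2 *\<^sub>R x) (\<i> *\<^sub>C z) = 0"
        using that complex_vector.subspace_scale[OF M(1) that] by (auto intro: inner0)
    qed
    then show ?thesis
      by (simp add: cinner_diff_left cinner_scaleR_left cinner_A)
  qed
  with x that show thesis
    by auto
qed

text \<open>
  The orthogonal complement of the eigenspaces is invariant under \<open>A\<close>, so a vector maximizing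
  \<open>norm (T x)\<close> on its unit sphere would be an eigenvector in it.
\<close>

lemma total_E_cinner:
  assumes "\<And>l e. e \<in> E l \<Longrightarrow> cinner x e = 0"
  shows "x = 0"
proof (rule ccontr)
  define M where "M = {x. \<forall>l. \<forall>e\<in>E l. cinner x e = 0}"
  assume "x \<noteq> 0"
  then have "M \<noteq> {0}"
    using assms by (auto simp: M_def)
  moreover have M: "csubspace M"
    by (auto simp: M_def complex_vector.subspace_def cinner_add_left cinner_scaleC_left)
  moreover have "closed M"
    unfolding M_def Collect_all_eq Collect_ball_eq
    by (intro closed_INT ballI closed_Collect_eq continuous_intros linear_continuous_on
        bounded_linear_cinner_left)
  ultimately obtain y where y: "y \<in> M" "norm y = 1"
      "\<And>z. z \<in> M \<Longrightarrow> cinner (T y) (T z) = (norm (T y))\<^sup>2 * cinner y z"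
    using maximizing_vector_exists by metis
  define d where "d = A y - (norm (T y))\<^sup>2 *\<^sub>R y"
  have "cinner (A y) e = 0" if "e \<in> E l" for e l
  proof -
    have "cinner (A y) e = cinner y (A e)"
      by (simp add: cinner_A cinner_A_right)
    then show ?thesis
      using that y(1) by (auto simp: E_def M_def cinner_scaleR_right)
  qed
  then have "A y \<in> M"
    by (auto simp: M_def)
  then have "d \<in> M"
    unfolding d_def scaleR_scaleC using M y(1)
    by (intro complex_vector.subspace_diff complex_vector.subspace_scale)
  then have "cinner d d = 0"
    using y(3)[of d] by (subst (1) d_def) (simp add: cinner_diff_left cinner_scaleR_left cinner_A)
  then have "y \<in> E ((norm (T y))\<^sup>2)"
    by (simp add: E_def d_def)
  then have "cinner y y = 0"
    using y(1) by (auto simp: M_def)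
  with y(2) show False
    by auto
qed

sublocale spectral_family E
proof
  show "subspace (E l)" for l
    by (rule csubspace_imp_subspace[OF csubspace_E])
  show "inner e f = 0" if "l \<noteq> m" "e \<in> E l" "f \<in> E m" for l m e f
    by (simp add: inner_eq_Re_cinner cinner_E_eq_0[OF that])
  show "x = 0" if *: "\<And>l e. e \<in> E l \<Longrightarrow> inner x e = 0" for x
  proof (rule total_E_cinner)
    show "cinner x e = 0" if "e \<in> E l" for l e
      using that by (intro cinner_eq_0_if_inner) (auto intro!: * complex_vector.subspace_scale csubspace_E)
  qed
qed

lemma eigenvalue_bounds:
  assumes "E l \<noteq> {0}"
  shows "0 \<le> l" "l \<le> (onorm T)\<^sup>2"
proof -
  obtain e where e: "e \<in> E l" "e \<noteq> 0"
    using assms subspace_0[OF subspace_E] by blast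
  have "0 \<le> l * (norm e)\<^sup>2" "l * (norm e)\<^sup>2 \<le> (onorm T)\<^sup>2 * (norm e)\<^sup>2"
    unfolding norm_T_E[OF e(1), symmetric] power_mult_distrib[symmetric]
    using onorm[OF bounded_linear_T, of e] by (auto intro: power_mono)
  with e(2) show "0 \<le> l" "l \<le> (onorm T)\<^sup>2"
    by (simp_all add: zero_le_mult_iff)
qed

lemma eigenvalue_nonneg: "e \<in> E l \<Longrightarrow> e \<noteq> 0 \<Longrightarrow> 0 \<le> l"
  using eigenvalue_bounds(1) by blast

section \<open>Finite-dimensionality of spectral subspaces\<close>

text \<open>A maximizer \<open>x\<close> on the closed span has
  \<open>(norm (T x))^2 \<ge> c\<close>, hence a value different from that of every
  \<open>g n\<close>. As with eigenvectors for distinct eigenvalues, this forces \<open>x\<close> to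
  be orthogonal to all \<open>g n\<close>, hence to the whole closed span, including itself.\<close>

lemma no_orthonormal_sequence_with_increasing_norms:
  fixes g :: "nat \<Rightarrow> 'a"
  assumes norm: "\<And>n. norm (g n) = 1"
    and orth: "\<And>n m. n \<noteq> m \<Longrightarrow> cinner (g n) (g m) = 0"
    and T_orth: "\<And>n m. n \<noteq> m \<Longrightarrow> cinner (T (g n)) (T (g m)) = 0"
    and less: "\<And>n. (norm (T (g n)))\<^sup>2 < c"
    and lim: "(\<lambda>n. (norm (T (g n)))\<^sup>2) \<longlonglongrightarrow> c"
  shows False
proof -
  define M where "M = closure (cspan (range g))"
  have g: "g n \<in> M" for n
    using closure_subset complex_vector.span_superset by (fastforce simp: M_def)
  have M_subset: "M \<subseteq> S" if "csubspace S" "closed S" "\<And>n. g n \<in> S" for S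
    unfolding M_def using that by (intro closure_minimal complex_vector.span_minimal) auto
  have M: "csubspace M" "closed M"
    by (simp_all add: M_def csubspace_closure)
  moreover have "M \<noteq> {0}"
    using g[of 0] norm[of 0] by auto
  ultimately obtain x where x: "x \<in> M" "norm x = 1" "\<And>y. y \<in> M \<Longrightarrow> norm (T y) \<le> norm (T x) * norm y"
      "\<And>z. z \<in> M \<Longrightarrow> cinner (T x) (T z) = (norm (T x))\<^sup>2 * cinner x z"
    using maximizing_vector_exists by metis
  have "c \<le> (norm (T x))\<^sup>2"
    using lim
  proof (rule LIMSEQ_le_const2)
    show "\<exists>N. \<forall>n\<ge>N. (norm (T (g n)))\<^sup>2 \<le> (norm (T x))\<^sup>2"
      using x(3)[OF g] norm by (auto intro!: power_mono)
  qed
  have "cinner x (g n) = 0" for n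
  proof -
    \<comment> \<open>Within the closed span, \<open>g n\<close> behaves like an eigenvector of
      \<open>A\<close>: the relation holds on the generators by the two orthogonality assumptions
      and persists under closed complex span.\<close>
    let ?S = "{z. cinner (T z) (T (g n)) = (norm (T (g n)))\<^sup>2 * cinner z (g n)}"
    have "x \<in> ?S"
    proof (rule subsetD[OF M_subset x(1)])
      show "csubspace ?S"
        using bounded_clinear_T
        by (auto simp: complex_vector.subspace_def bounded_clinear_iff linear_simps
            cinner_add_left cinner_scaleC_left algebra_simps)
      show "closed ?S"
        by (intro closed_Collect_eq continuous_intros linear_continuous_on bounded_linear_cinner_left
            bounded_linear_compose[OF bounded_linear_cinner_left bounded_linear_T])
      show "g m \<in> ?S" for m
        using orth[of m n] T_orth[of m n] norm[of n] by (cases "m = n") (simp_all add: cinner_self)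
    qed
    then have "((norm (T x))\<^sup>2 - (norm (T (g n)))\<^sup>2) * cinner x (g n) = 0"
      using x(4)[OF g, of n] by (simp add: left_diff_distrib)
    moreover have "(norm (T (g n)))\<^sup>2 \<noteq> (norm (T x))\<^sup>2"
      using less[of n] \<open>c \<le> _\<close> by linarith
    ultimately show ?thesis
      by (simp flip: of_real_power of_real_diff)
  qed
  moreover have "csubspace {z. cinner x z = 0}"
    by (simp add: complex_vector.subspace_def cinner_add_right cinner_scaleC_right)
  moreover have "closed {z. cinner x z = 0}"
    by (intro closed_Collect_eq continuous_on_const linear_continuous_on bounded_linear_cinner_right)
  ultimately have "M \<subseteq> {z. cinner x z = 0}"
    by (intro M_subset) simp_all
  with x(1) have "cinner x x = 0"
    by blast
  with x(2) show False
    by auto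
qed

text \<open>As the eigenspaces are total, this says that the spectral subspace for \<open>S\<close> is infinite-dimensional.\<close>

definition spectral_infinite :: "real set \<Rightarrow> bool" where
  "spectral_infinite S \<longleftrightarrow> (\<exists>(g :: nat \<Rightarrow> 'a) lam.
    (\<forall>n. norm (g n) = 1 \<and> lam n \<in> S \<and> g n \<in> E (lam n)) \<and> (\<forall>n m. n \<noteq> m \<longrightarrow> cinner (g n) (g m) = 0))"

lemma spectral_infinite_mono: "spectral_infinite S \<Longrightarrow> S \<subseteq> S' \<Longrightarrow> spectral_infinite S'"
  unfolding spectral_infinite_def by blast

text \<open>One finite system serves all eigenspaces with \<open>l \<in> S\<close>: its members are
  eigenvectors, and those outside \<open>E l\<close> are orthogonal to \<open>E l\<close>, so they
  contribute nothing to expansions there.\<close>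

lemma spectral_finite_basis:
  assumes "\<not> spectral_infinite S"
  obtains B where "finite B" "orthonormal_set B"
    "\<And>l e. l \<in> S \<Longrightarrow> e \<in> E l \<Longrightarrow> e = (\<Sum>b\<in>B. cinner e b *\<^sub>C b)"
proof -
  obtain B where B: "B \<subseteq> (\<Union>l\<in>S. E l)" "orthonormal_set B"
      and max: "\<And>x. x \<in> (\<Union>l\<in>S. E l) \<Longrightarrow> (\<And>b. b \<in> B \<Longrightarrow> cinner x b = 0) \<Longrightarrow> norm x \<noteq> 1"
    using maximal_orthonormal_subset_exists by metis
  have fin: "finite B"
  proof (rule ccontr)
    assume "infinite B"
    then obtain g :: "nat \<Rightarrow> 'a" where g: "inj g" "range g \<subseteq> B"
      using infinite_countable_subset by blast
    then have "\<forall>n. \<exists>l. l \<in> S \<and> g n \<in> E l"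
      using B(1) by blast
    then obtain lam where "\<And>n. lam n \<in> S \<and> g n \<in> E (lam n)"
      by metis
    moreover have "norm (g n) = 1" for n
      using g B(2) by (auto simp: orthonormal_set_def)
    moreover have "cinner (g n) (g m) = 0" if "n \<noteq> m" for n m
    proof -
      have "g n \<noteq> g m" "g n \<in> B" "g m \<in> B"
        using injD[OF g(1), of n m] g(2) that by auto
      with B(2) show ?thesis
        unfolding orthonormal_set_def by blast
    qed
    ultimately show False
      using assms unfolding spectral_infinite_def by blast
  qed
  have "e = (\<Sum>b\<in>B. cinner e b *\<^sub>C b)" if l: "l \<in> S" "e \<in> E l" for l e
  proof -
    have other: "cinner x b = 0" if "b \<in> B - E l" "x \<in> E l" for x b
    proof -
      obtain m where "b \<in> E m"
        using \<open>b \<in> B - E l\<close> B(1) by blast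
      moreover from this have "l \<noteq> m"
        using \<open>b \<in> B - E l\<close> by blast
      ultimately show ?thesis
        using cinner_E_eq_0 \<open>x \<in> E l\<close> by blast
    qed
    have "e = (\<Sum>b\<in>B \<inter> E l. cinner e b *\<^sub>C b)"
    proof (rule orthonormal_expansion[OF csubspace_E])
      show "norm x \<noteq> 1" if "x \<in> E l" "\<And>b. b \<in> B \<inter> E l \<Longrightarrow> cinner x b = 0" for x
        using max[of x] that other l(1) by blast
    qed (use B(2) fin l(2) in \<open>auto simp: orthonormal_set_def\<close>)
    also have "\<dots> = (\<Sum>b\<in>B. cinner e b *\<^sub>C b)"
      using fin other[OF _ l(2)] by (intro sum.mono_neutral_left) auto
    finally show ?thesis .
  qed
  with fin B(2) that show thesis
    by blast
qed

text \<open>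
  Combining eigenvectors for eigenvalues below \<open>t\<close> and above \<open>s\<close> yields an orthonormal sequence
  for which \<open>(norm (T (g n)))\<^sup>2\<close> takes the prescribed values \<open>w n\<close>, which increase to \<open>s\<close>.
\<close>

lemma not_spectral_infinite_on_both_sides:
  assumes "t < s"
  shows "\<not> (spectral_infinite {..<t} \<and> spectral_infinite {s<..})"
proof
  assume "spectral_infinite {..<t} \<and> spectral_infinite {s<..}"
  then obtain e f :: "nat \<Rightarrow> 'a" and lam mu where
    e: "\<And>n. norm (e n) = 1" "\<And>n. lam n < t" "\<And>n. e n \<in> E (lam n)"
      "\<And>n m. n \<noteq> m \<Longrightarrow> cinner (e n) (e m) = 0" and
    f: "\<And>n. norm (f n) = 1" "\<And>n. s < mu n" "\<And>n. f n \<in> E (mu n)"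
      "\<And>n m. n \<noteq> m \<Longrightarrow> cinner (f n) (f m) = 0"
    unfolding spectral_infinite_def lessThan_iff greaterThan_iff by metis
  \<comment> \<open>Since \<open>w 0 = t\<close>, every \<open>w n\<close> lies in [t, s), hence
    strictly between \<open>lam n\<close> and \<open>mu n\<close>. \<open>p n\<close> is the convex
    weight with \<open>(1 - p n) * lam n + p n * mu n = w n\<close>; square roots as coefficients
    make \<open>g n\<close> a unit vector.\<close>
  define w where "w n = s - (s - t) * (1 / real (Suc n))" for n
  define p where "p n = (w n - lam n) / (mu n - lam n)" for n
  define g where "g n = sqrt (1 - p n) *\<^sub>R e n + sqrt (p n) *\<^sub>R f n" for n
  have w: "t \<le> w n" "w n < s" for n
  proof -
    define q where "q = (s - t) * (1 / real (Suc n))"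
    have "q \<le> (s - t) * 1"
      unfolding q_def using assms by (intro mult_left_mono) auto
    moreover have "0 < q"
      unfolding q_def using assms by (intro mult_pos_pos) auto
    moreover have "w n = s - q"
      by (simp add: w_def q_def)
    ultimately show "t \<le> w n" "w n < s"
      by simp_all
  qed
  have bounds: "lam n < w n" "w n < mu n" for n
    using w[of n] e(2)[of n] f(2)[of n] by linarith+
  have p: "0 \<le> p n" "p n \<le> 1" for n
    using bounds[of n] by (simp_all add: p_def divide_le_eq_1)
  \<comment> \<open>All \<open>lam\<close> lie below t and all \<open>mu\<close> above s > t, so no
    \<open>e n\<close> shares an eigenvalue with any \<open>f m\<close>.\<close>
  have ef: "cinner (e n) (f m) = 0" "cinner (f m) (e n) = 0" for n m
    using cinner_E_eq_0[OF _ e(3) f(3), of n m] cinner_E_eq_0[OF _ f(3) e(3), of m n]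
      e(2)[of n] f(2)[of m] assms by auto
  have unit: "cinner (e n) (e n) = 1" "cinner (f n) (f n) = 1" for n
    by (simp_all add: cinner_self e(1) f(1))
  have g_g: "cinner (g n) (g n) = 1" for n
    using p[of n]
    by (simp add: g_def cinner_add_left cinner_add_right cinner_scaleR_left cinner_scaleR_right ef
        unit flip: of_real_mult of_real_add)
  have A_g: "A (g n) = (sqrt (1 - p n) * lam n) *\<^sub>R e n + (sqrt (p n) * mu n) *\<^sub>R f n" for n
    using e(3)[of n] f(3)[of n] bounded_clinear_bounded_linear[OF bounded_clinear_A]
    by (simp add: g_def linear_simps E_def)
  have val: "(norm (T (g n)))\<^sup>2 = w n" for n
  proof -
    have "complex_of_real ((norm (T (g n)))\<^sup>2) = cinner (A (g n)) (g n)"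
      unfolding cinner_A cinner_self ..
    also have "\<dots> = complex_of_real (sqrt (1 - p n) * lam n * sqrt (1 - p n) + sqrt (p n) * mu n * sqrt (p n))"
      unfolding A_g
      by (simp add: g_def cinner_add_left cinner_add_right cinner_scaleR_left cinner_scaleR_right ef
          unit flip: of_real_mult of_real_add)
    also have "sqrt (1 - p n) * lam n * sqrt (1 - p n) + sqrt (p n) * mu n * sqrt (p n)
        = (1 - p n) * lam n + p n * mu n"
      using p[of n] by (simp add: mult.commute mult.left_commute)
    also have "\<dots> = lam n + p n * (mu n - lam n)"
      by (simp add: algebra_simps)
    also have "\<dots> = w n"
      using bounds[of n] by (simp add: p_def)
    finally show ?thesis
      by (simp only: of_real_eq_iff)
  qed
  show False
  proof (rule no_orthonormal_sequence_with_increasing_norms[of g s])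
    show "norm (g n) = 1" for n
      using g_g[of n] unfolding cinner_self by (simp flip: of_real_power add: power2_eq_1_iff)
        (smt (verit) norm_ge_zero)
    show "cinner (g n) (g m) = 0" if "n \<noteq> m" for n m
      by (simp add: g_def cinner_add_left cinner_add_right cinner_scaleR_left cinner_scaleR_right
          ef e(4)[OF that] f(4)[OF that])
    show "cinner (T (g n)) (T (g m)) = 0" if "n \<noteq> m" for n m
      unfolding cinner_A[symmetric] A_g
      by (simp add: g_def cinner_add_left cinner_add_right cinner_scaleR_left cinner_scaleR_right
          ef e(4)[OF that] f(4)[OF that])
    show "(norm (T (g n)))\<^sup>2 < s" for n
      by (simp add: val w)
    have "(\<lambda>n. s - (s - t) * (1 / real (Suc n))) \<longlonglongrightarrow> s - (s - t) * 0"
      by (intro tendsto_intros LIMSEQ_Suc lim_1_over_n)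
    then show "(\<lambda>n. (norm (T (g n)))\<^sup>2) \<longlonglongrightarrow> s"
      by (simp add: val w_def)
  qed
qed

text \<open>The restriction to nonnegative levels bounds the set from below; the set contains
  \<open>(onorm T)\<^sup>2\<close>, so the infimum is genuine, and it is nonnegative, as its square
  root is to be \<alpha>.\<close>

definition threshold :: real where
  "threshold = Inf {s. 0 \<le> s \<and> \<not> spectral_infinite {s<..}}"

lemma finite_above_onorm: "\<not> spectral_infinite {(onorm T)\<^sup>2<..}"
proof
  assume "spectral_infinite {(onorm T)\<^sup>2<..}"
  then obtain e l where e: "norm e = 1" "l \<in> {(onorm T)\<^sup>2<..}" "e \<in> E l"
    unfolding spectral_infinite_def by metis
  then have "E l \<noteq> {0}"
    by force
  from eigenvalue_bounds(2)[OF this] e(2) show False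
    by simp
qed

lemma threshold_nonneg: "0 \<le> threshold"
  unfolding threshold_def using finite_above_onorm
  by (intro cInf_greatest) (auto intro!: exI[of _ "(onorm T)\<^sup>2"])

lemma spectral_finite_above_threshold:
  assumes "threshold < s"
  shows "\<not> spectral_infinite {s<..}"
proof -
  obtain s' where "\<not> spectral_infinite {s'<..}" "s' < s"
    using assms finite_above_onorm unfolding threshold_def
    by (subst (asm) cInf_less_iff) (auto intro!: bdd_belowI[of _ 0] zero_le_power2)
  then show ?thesis
    using spectral_infinite_mono[of "{s<..}" "{s'<..}"] by auto
qed

text \<open>If infinitely many \<open>lam n\<close> were below some t < \<open>threshold\<close>,
  infinite-dimensional parts would lie on both sides of a gap. Otherwise \<open>lam\<close>
  converges to \<open>threshold\<close> from strictly below, and \<open>g\<close> is itself a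
  forbidden sequence.\<close>

lemma spectral_finite_below_threshold: "\<not> spectral_infinite {..<threshold}"
proof
  assume "spectral_infinite {..<threshold}"
  then obtain g :: "nat \<Rightarrow> 'a" and lam where
    g: "\<And>n. norm (g n) = 1" "\<And>n. lam n < threshold" "\<And>n. g n \<in> E (lam n)"
      "\<And>n m. n \<noteq> m \<Longrightarrow> cinner (g n) (g m) = 0"
    unfolding spectral_infinite_def lessThan_iff by metis
  have val: "(norm (T (g n)))\<^sup>2 = lam n" for n
    using norm_T_E[OF g(3)[of n]] g(1)[of n] by simp
  have lam: "0 \<le> lam n" for n
    by (metis val zero_le_power2)
  have "finite {n. lam n < t}" if "t < threshold" for t
  proof (rule ccontr)
    let ?N = "{n. lam n < t}"
    assume inf: "infinite ?N"
    then obtain n where "lam n < t"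
      by (metis (mono_tags, lifting) finite.emptyI empty_Collect_eq)
    \<comment> \<open>Positivity of t makes the midpoint \<open>s\<close> below a nonnegative level,
      hence a candidate in the infimum defining \<open>threshold\<close>.\<close>
    with lam[of n] have "0 < t"
      by linarith
    define s where "s = (t + threshold) / 2"
    have s: "t < s" "s < threshold"
      using that by (simp_all add: s_def)
    have "spectral_infinite {s<..}"
    proof (rule ccontr)
      assume "\<not> spectral_infinite {s<..}"
      then have "threshold \<le> s"
        unfolding threshold_def using s(1) \<open>0 < t\<close>
        by (intro cInf_lower bdd_belowI[of _ 0]) auto
      with s(2) show False
        by simp
    qed
    moreover have "spectral_infinite {..<t}"
      unfolding spectral_infinite_def
    \<comment> \<open>Enumerating the infinite index set selects the subsequence of eigenvectors
      with eigenvalue below t.\<close>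
    proof (intro exI conjI allI impI)
      show "norm ((g \<circ> enumerate ?N) n) = 1" "(g \<circ> enumerate ?N) n \<in> E ((lam \<circ> enumerate ?N) n)" for n
        by (simp_all add: g)
      show "(lam \<circ> enumerate ?N) n \<in> {..<t}" for n
        using enumerate_in_set[OF inf, of n] by simp
      show "cinner ((g \<circ> enumerate ?N) n) ((g \<circ> enumerate ?N) m) = 0" if "n \<noteq> m" for n m
        using g(4) that strict_mono_enumerate[OF inf] by (simp add: strict_mono_eq)
    qed
    ultimately show False
      using not_spectral_infinite_on_both_sides[OF s(1)] by blast
  qed
  then have "eventually (\<lambda>n. t \<le> lam n) sequentially" if "t < threshold" for t
    using that by (simp add: eventually_cofinite not_le flip: cofinite_eq_sequentially)
  then have "eventually (\<lambda>n. t < lam n) sequentially" if t: "t < threshold" for t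
  proof -
    obtain z where "t < z" "z < threshold"
      using dense[OF t] by blast
    then show ?thesis
      using \<open>\<And>t. t < threshold \<Longrightarrow> eventually (\<lambda>n. t \<le> lam n) sequentially\<close>[of z]
      by (auto elim: eventually_mono)
  qed
  then have "lam \<longlonglongrightarrow> threshold"
    using less_trans[OF g(2)] by (intro order_tendstoI) (simp_all add: always_eventually)
  then show False
    using no_orthonormal_sequence_with_increasing_norms[of g threshold] g cinner_E_eq_0
    by (auto simp: val cinner_scaleR_left E_def simp flip: cinner_A)
qed

end

section \<open>Functional calculus and the polar decomposition\<close>

context an_operator
begin

lemma bounded_symbolI:
  assumes "\<And>l. 0 \<le> l \<Longrightarrow> l \<le> (onorm T)\<^sup>2 \<Longrightarrow> \<bar>\<phi> l\<bar> \<le> C" "0 \<le> C"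
  shows "bounded_symbol \<phi> C"
  using assms eigenvalue_bounds by (auto simp: bounded_symbol_def)

text \<open>Eigenspaces for negative \<open>l\<close> are trivial, so formulas involving
  \<open>sqrt l\<close> need only be checked for nonnegative \<open>l\<close>.\<close>

lemma ext_E_nonneg:
  assumes f: "bounded_linear f" and g: "bounded_linear g"
    and eq: "\<And>l e. e \<in> E l \<Longrightarrow> 0 \<le> l \<Longrightarrow> f e = g e"
  shows "f = g"
proof (rule ext_E[OF f g])
  show "f e = g e" if "e \<in> E l" for l e
    using eq[OF that] eigenvalue_nonneg[OF that] f g by (cases "e = 0") (simp_all add: linear_simps)
qed

lemma diag_op_eq_nonneg:
  assumes "bounded_symbol \<phi> C" "bounded_linear f"
    and "\<And>l e. e \<in> E l \<Longrightarrow> 0 \<le> l \<Longrightarrow> f e = \<phi> l *\<^sub>R e"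
  shows "f = diag_op \<phi>"
  using assms by (intro ext_E_nonneg) (auto simp: bounded_linear_diag_op diag_op_E)

lemma scaleR_in_E: "e \<in> E l \<Longrightarrow> c *\<^sub>R e \<in> E l"
  by (rule subspace_scale[OF subspace_E])

lemma bounded_clinear_diag_op:
  assumes \<phi>: "bounded_symbol \<phi> C"
  shows "bounded_clinear (diag_op \<phi>)"
proof -
  note lin = bounded_linear_diag_op[OF \<phi>]
  have "(\<lambda>x. diag_op \<phi> (c *\<^sub>C x)) = (\<lambda>x. c *\<^sub>C diag_op \<phi> x)" for c
  proof (rule ext_E)
    show "bounded_linear (\<lambda>x. diag_op \<phi> (c *\<^sub>C x))" "bounded_linear (\<lambda>x. c *\<^sub>C diag_op \<phi> x)"
      using bounded_linear_compose[OF lin bounded_linear_scaleC_right]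
        bounded_linear_compose[OF bounded_linear_scaleC_right lin] .
    show "diag_op \<phi> (c *\<^sub>C e) = c *\<^sub>C diag_op \<phi> e" if "e \<in> E l" for l e
      using that complex_vector.subspace_scale[OF csubspace_E that, of c]
      by (simp add: diag_op_E scaleR_scaleC scaleC_scaleC mult.commute)
  qed
  with lin show ?thesis
    unfolding bounded_clinear_iff by metis
qed

lemma self_adjoint_diag_op: "bounded_symbol \<phi> C \<Longrightarrow> self_adjoint_op (diag_op \<phi>)"
  by (intro self_adjoint_opI bounded_clinear_diag_op diag_op_symmetric)

lemma positive_diag_op:
  assumes \<phi>: "bounded_symbol \<phi> C" and nonneg: "\<And>l. 0 \<le> l \<Longrightarrow> \<phi> l \<ge> 0"
  shows "positive_op (diag_op \<phi>)"
proof -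
  note sa = self_adjoint_diag_op[OF \<phi>]
  have "cinner (diag_op \<phi> x) x \<in> \<real>\<^sub>\<ge>\<^sub>0" for x
  proof -
    have "cinner (diag_op \<phi> x) x = cinner x (diag_op \<phi> x)"
      using sa cinner_cadjoint[of "diag_op \<phi>" x x] by (simp add: self_adjoint_op_def)
    then have "Im (cinner (diag_op \<phi> x) x) = 0"
      using cinner_commute[of "diag_op \<phi> x" x] by (metis complex_cnj_cancel_iff Reals_cnj_iff complex_is_Real_iff)
    moreover have "0 \<le> Re (cinner (diag_op \<phi> x) x)"
      using inner_diag_op_nonneg[OF \<phi>, of x] nonneg eigenvalue_bounds(1)
      by (simp add: inner_eq_Re_cinner)
    ultimately show ?thesis
      by (simp add: complex_nonneg_Reals_iff)
  qed
  with sa show ?thesis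
    by (simp add: positive_op_def)
qed

text \<open>Eigenvectors with index outside \<open>S\<close> are annihilated and the others are
  expanded by the finite basis. It yields the finite rank of \<open>F\<close> as well as the
  approximants of \<open>K\<close>.\<close>

lemma diag_op_finite_expansion:
  assumes \<phi>: "bounded_symbol \<phi> C" and B: "finite B"
    and basis: "\<And>l e. l \<in> S \<Longrightarrow> e \<in> E l \<Longrightarrow> e = (\<Sum>b\<in>B. cinner e b *\<^sub>C b)"
    and supp: "\<And>l. l \<notin> S \<Longrightarrow> \<phi> l = 0"
  shows "diag_op \<phi> x = (\<Sum>b\<in>B. cinner (diag_op \<phi> x) b *\<^sub>C b)"
proof -
  note lin = bounded_linear_diag_op[OF \<phi>]
  have "diag_op \<phi> = (\<lambda>x. \<Sum>b\<in>B. cinner (diag_op \<phi> x) b *\<^sub>C b)"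
  proof (rule ext_E[OF lin])
    show "bounded_linear (\<lambda>x. \<Sum>b\<in>B. cinner (diag_op \<phi> x) b *\<^sub>C b)"
      by (intro bounded_linear_sum bounded_linear_compose[OF bounded_linear_scaleC_left]
          bounded_linear_compose[OF bounded_linear_cinner_left] lin)
    show "diag_op \<phi> e = (\<Sum>b\<in>B. cinner (diag_op \<phi> e) b *\<^sub>C b)" if "e \<in> E l" for l e
    proof (cases "l \<in> S")
      case True
      then show ?thesis
        using basis[OF True scaleR_in_E[OF that]] that by (simp add: diag_op_E)
    next
      case False
      then show ?thesis
        using supp[OF False] that by (simp add: diag_op_E)
    qed
  qed
  then show ?thesis
    by meson
qed

section \<open>The modulus of T\<close>

lemma bounded_symbol_sqrt: "bounded_symbol sqrt (onorm T)"
  using onorm_pos_le[OF bounded_linear_T] by (intro bounded_symbolI) (auto intro: real_le_lsqrt)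

lemma bounded_linear_A: "bounded_linear A"
  by (rule bounded_clinear_bounded_linear[OF bounded_clinear_A])

text \<open>A positive square root of \<open>A\<close> maps an eigenvector \<open>e\<close> for \<open>l\<close> to \<open>sqrt l *\<^sub>R e\<close>: the vector
  \<open>y = S e - sqrt l *\<^sub>R e\<close> satisfies \<open>S y = - sqrt l *\<^sub>R y\<close>.\<close>

lemma positive_sqrt_A_E:
  assumes S: "positive_op S" "S \<circ> S = A" and e: "e \<in> E l" "0 \<le> l"
  shows "S e = sqrt l *\<^sub>R e"
proof -
  have S': "bounded_clinear S" "cadjoint S = S"
    using S(1) by (auto simp: positive_op_def self_adjoint_op_def)
  note lin = bounded_clinear_bounded_linear[OF S'(1)]
  have SS: "S (S e) = l *\<^sub>R e"
    using S(2) e(1) by (simp add: E_def fun_eq_iff)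
  show ?thesis
  proof (cases "l = 0")
    case True
    \<comment> \<open>For \<open>l = 0\<close> the sign argument of the other case gives no
      information, since \<open>- sqrt l\<close> is 0; self-adjointness settles it.\<close>
    have "cinner (S e) (S e) = cinner e (S (S e))"
      using cinner_cadjoint[OF S'(1)] S'(2) by simp
    with True SS show ?thesis
      by simp
  next
    case False
    define y where "y = S e - sqrt l *\<^sub>R e"
    have "S y = - sqrt l *\<^sub>R y"
      using SS e(2) lin by (simp add: y_def linear_simps scaleR_diff_right)
    then have "cinner (S y) y = complex_of_real (- sqrt l * (norm y)\<^sup>2)"
      by (simp only: cinner_scaleR_left cinner_self of_real_mult)
    moreover have "cinner (S y) y \<in> \<real>\<^sub>\<ge>\<^sub>0"
      using S(1) by (simp add: positive_op_def)
    ultimately have "- sqrt l * (norm y)\<^sup>2 \<ge> 0"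
      by (metis nonneg_Reals_of_real_iff)
    moreover have "sqrt l > 0"
      using False e(2) by simp
    ultimately have "y = 0"
      by (smt (verit) mult_minus_left mult_pos_pos zero_less_norm_iff zero_less_power)
    then show ?thesis
      by (simp add: y_def)
  qed
qed

text \<open>The description operator requires existence and uniqueness of the positive root;
  uniqueness holds because every such root acts as \<open>sqrt l\<close> on
  \<open>E l\<close>.\<close>

lemma op_abs_eq: "op_abs T = diag_op sqrt"
  unfolding op_abs_def op_sqrt_def A_def[symmetric]
proof (rule the_equality)
  note lin = bounded_linear_diag_op[OF bounded_symbol_sqrt]
  have "diag_op sqrt \<circ> diag_op sqrt = A"
  proof (rule ext_E_nonneg)
    show "bounded_linear (diag_op sqrt \<circ> diag_op sqrt)"
      unfolding comp_def by (rule bounded_linear_compose[OF lin lin])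
    show "(diag_op sqrt \<circ> diag_op sqrt) e = A e" if "e \<in> E l" "0 \<le> l" for l e
      using that diag_op_E[OF scaleR_in_E[OF that(1)]] by (simp add: diag_op_E) (simp add: E_def)
  qed (rule bounded_linear_A)
  then show "positive_op (diag_op sqrt) \<and> diag_op sqrt \<circ> diag_op sqrt = A"
    using positive_diag_op[OF bounded_symbol_sqrt] by simp
next
  fix S assume S: "positive_op S \<and> S \<circ> S = A"
  then have "bounded_linear S"
    by (auto simp: positive_op_def self_adjoint_op_def bounded_clinear_iff)
  then show "S = diag_op sqrt"
    using S positive_sqrt_A_E by (intro diag_op_eq_nonneg[OF bounded_symbol_sqrt]) auto
qed

end

section \<open>The polar factor on the eigenspaces\<close>

locale normal_an_operator = an_operator +
  fixes V
  assumes normal: "normal_op T"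
    and polar: "polar_decomposition T V"
begin

lemma bounded_clinear_V: "bounded_clinear V"
  using polar by (simp add: polar_decomposition_def partial_isometry_def)

lemmas bounded_linear_V = bounded_clinear_bounded_linear[OF bounded_clinear_V]
lemmas bounded_clinear_V_adj = bounded_clinear_cadjoint[OF bounded_clinear_V]
lemmas bounded_linear_V_adj = bounded_clinear_bounded_linear[OF bounded_clinear_V_adj]
lemmas bounded_linear_T_adj = bounded_clinear_bounded_linear[OF bounded_clinear_cadjoint[OF bounded_clinear_T]]

lemma normal_commute: "cadjoint T (T x) = T (cadjoint T x)"
  using normal by (simp add: normal_op_def fun_eq_iff)

text \<open>Here normality enters: \<open>T\<close> commutes with its adjoint, hence with
  \<open>A\<close>.\<close>

lemma T_in_E: "e \<in> E l \<Longrightarrow> T e \<in> E l"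
  using normal_commute[of "T e"] bounded_linear_T by (simp add: E_def A_def linear_simps)

lemma T_adj_in_E: "e \<in> E l \<Longrightarrow> cadjoint T e \<in> E l"
  using bounded_linear_T_adj by (simp add: E_def A_def linear_simps flip: normal_commute)

text \<open>For \<open>l = 0\<close> both sides vanish, since \<open>1 / 0 = 0\<close>.\<close>

lemma V_E:
  assumes e: "e \<in> E l" "0 \<le> l"
  shows "V e = (1 / sqrt l) *\<^sub>R T e"
proof (cases "l = 0")
  case True
  then have "T e = 0"
    using norm_T_E[OF e(1)] by simp
  then have "V e = 0"
    using polar by (auto simp: polar_decomposition_def null_space_def)
  with True show ?thesis
    by simp
next
  case False
  have "T e = V (op_abs T e)"
    using polar unfolding polar_decomposition_def by (metis comp_apply)
  also have "\<dots> = sqrt l *\<^sub>R V e"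
    using e bounded_linear_V by (simp add: op_abs_eq diag_op_E linear_simps)
  finally show ?thesis
    using False e(2) by simp
qed

lemma V_in_E: "e \<in> E l \<Longrightarrow> 0 \<le> l \<Longrightarrow> V e \<in> E l"
  by (simp add: V_E T_in_E scaleR_in_E)

text \<open>Tested against eigenvectors \<open>f\<close> for \<open>m\<close>: if \<open>m\<close>
  differs from \<open>l\<close>, both sides vanish because \<open>T f\<close> stays in
  \<open>E m\<close>; if \<open>m = l\<close>, the factors \<open>1 / sqrt m\<close> and
  \<open>1 / sqrt l\<close> coincide.\<close>

lemma V_adj_E:
  assumes e: "e \<in> E l" "0 \<le> l"
  shows "cadjoint V e = (1 / sqrt l) *\<^sub>R cadjoint T e"
proof (rule inner_ext_E)
  fix m f assume f: "f \<in> E m"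
  show "inner (cadjoint V e) f = inner ((1 / sqrt l) *\<^sub>R cadjoint T e) f"
  proof (cases "f = 0")
    case False
    then have m: "0 \<le> m"
      using eigenvalue_nonneg f by blast
    have *: "cinner e (T f) = 0" if "m \<noteq> l"
      using cinner_E_eq_0[OF _ e(1) T_in_E[OF f]] that by blast
    have "cinner e (V f) = (1 / sqrt l) * cinner e (T f)"
      using * by (cases "m = l") (simp_all add: V_E[OF f m] cinner_scaleR_right)
    then show ?thesis
      by (simp add: inner_eq_Re_cinner cinner_scaleR_left
          cinner_cadjoint_left[OF bounded_clinear_V] cinner_cadjoint_left[OF bounded_clinear_T])
  qed simp
qed

lemma V_adj_in_E: "e \<in> E l \<Longrightarrow> 0 \<le> l \<Longrightarrow> cadjoint V e \<in> E l"
  by (simp add: V_adj_E T_adj_in_E scaleR_in_E)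

text \<open>The symbol of the orthogonal projection onto the complement of the kernel of
  \<open>T\<close>.\<close>

definition support_symbol :: "real \<Rightarrow> real" where
  "support_symbol l = (if l = 0 then 0 else 1)"

lemma
  assumes e: "e \<in> E l" "0 \<le> l"
  shows V_adj_V_E: "cadjoint V (V e) = support_symbol l *\<^sub>R e"
    and V_V_adj_E: "V (cadjoint V e) = support_symbol l *\<^sub>R e"
proof -
  have *: "(1 / sqrt l) *\<^sub>R (1 / sqrt l) *\<^sub>R (l *\<^sub>R e) = support_symbol l *\<^sub>R e"
    using e(2) by (simp add: support_symbol_def)
  have TT: "cadjoint T (T e) = l *\<^sub>R e"
    using e(1) by (simp add: E_def A_def)
  have "cadjoint V (V e) = (1 / sqrt l) *\<^sub>R (1 / sqrt l) *\<^sub>R (cadjoint T (T e))"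
    using V_adj_E[OF V_in_E[OF e] e(2)] bounded_linear_T_adj by (simp add: V_E[OF e] linear_simps)
  then show "cadjoint V (V e) = support_symbol l *\<^sub>R e"
    unfolding TT * .
  have "V (cadjoint V e) = (1 / sqrt l) *\<^sub>R (1 / sqrt l) *\<^sub>R (T (cadjoint T e))"
    using V_E[OF V_adj_in_E[OF e] e(2)] bounded_linear_T by (simp add: V_adj_E[OF e] linear_simps)
  then show "V (cadjoint V e) = support_symbol l *\<^sub>R e"
    unfolding normal_commute[symmetric] TT * .
qed

text \<open>\<open>V\<close> maps each \<open>E l\<close> into itself, and
  \<open>diag_op \<phi>\<close> is a scalar there.\<close>

lemma diag_op_commutes_V:
  assumes \<phi>: "bounded_symbol \<phi> C"
  shows "diag_op \<phi> \<circ> V = V \<circ> diag_op \<phi>"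
proof (rule ext_E_nonneg)
  note lin = bounded_linear_diag_op[OF \<phi>]
  show "bounded_linear (diag_op \<phi> \<circ> V)" "bounded_linear (V \<circ> diag_op \<phi>)"
    unfolding comp_def
    using bounded_linear_compose[OF lin bounded_linear_V] bounded_linear_compose[OF bounded_linear_V lin] .
  show "(diag_op \<phi> \<circ> V) e = (V \<circ> diag_op \<phi>) e" if "e \<in> E l" "0 \<le> l" for l e
    using that bounded_linear_V by (simp add: diag_op_E V_in_E linear_simps)
qed

lemma
  assumes \<phi>: "bounded_symbol \<phi> C"
  shows bounded_clinear_V_diag_op: "bounded_clinear (V \<circ> diag_op \<phi>)"
    and cadjoint_V_diag_op: "cadjoint (V \<circ> diag_op \<phi>) = diag_op \<phi> \<circ> cadjoint V"
  using bounded_clinear_comp[OF bounded_clinear_V bounded_clinear_diag_op[OF \<phi>]]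
    cadjoint_comp_self_adjoint[OF bounded_clinear_V self_adjoint_diag_op[OF \<phi>]] .

lemma bounded_symbol_power2_support:
  assumes "bounded_symbol \<phi> C"
  shows "bounded_symbol (\<lambda>l. (\<phi> l)\<^sup>2 * support_symbol l) (C\<^sup>2)"
  using assms by (auto simp: bounded_symbol_def support_symbol_def abs_le_square_iff[symmetric])

text \<open>The two products of \<open>V\<close> and its adjoint have the same symbol, so both
  orders of composition give the same diagonal operator.\<close>

lemma
  assumes \<phi>: "bounded_symbol \<phi> C"
  shows adj_V_diag_op: "cadjoint (V \<circ> diag_op \<phi>) \<circ> (V \<circ> diag_op \<phi>) =
      diag_op (\<lambda>l. (\<phi> l)\<^sup>2 * support_symbol l)" (is ?adj)
    and normal_op_V_diag_op: "normal_op (V \<circ> diag_op \<phi>)"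
proof -
  note clin = bounded_clinear_V_diag_op[OF \<phi>]
  note lin = bounded_linear_diag_op[OF \<phi>]
  note simps = cadjoint_V_diag_op[OF \<phi>] diag_op_E V_in_E V_adj_in_E V_adj_V_E V_V_adj_E
    linear_simps[OF lin] linear_simps[OF bounded_linear_V] linear_simps[OF bounded_linear_V_adj]
    power2_eq_square scaleR_in_E
  show ?adj
  proof (rule diag_op_eq_nonneg[OF bounded_symbol_power2_support[OF \<phi>]])
    show "bounded_linear (cadjoint (V \<circ> diag_op \<phi>) \<circ> (V \<circ> diag_op \<phi>))"
      by (intro bounded_clinear_bounded_linear bounded_clinear_comp bounded_clinear_cadjoint clin)
  qed (simp add: simps)
  moreover have "(V \<circ> diag_op \<phi>) \<circ> cadjoint (V \<circ> diag_op \<phi>) = diag_op (\<lambda>l. (\<phi> l)\<^sup>2 * support_symbol l)"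
  proof (rule diag_op_eq_nonneg[OF bounded_symbol_power2_support[OF \<phi>]])
    show "bounded_linear ((V \<circ> diag_op \<phi>) \<circ> cadjoint (V \<circ> diag_op \<phi>))"
      by (intro bounded_clinear_bounded_linear bounded_clinear_comp bounded_clinear_cadjoint clin)
    show "((V \<circ> diag_op \<phi>) \<circ> cadjoint (V \<circ> diag_op \<phi>)) e = ((\<phi> l)\<^sup>2 * support_symbol l) *\<^sub>R e"
      if "e \<in> E l" "0 \<le> l" for l e
      using that by (simp add: simps diag_op_E[OF V_adj_in_E[OF that]])
  qed
  ultimately show "normal_op (V \<circ> diag_op \<phi>)"
    using clin by (simp add: normal_op_def)
qed

section \<open>The decomposition\<close>

definition \<alpha> :: real where
  "\<alpha> = sqrt threshold"

text \<open>Positive part of \<open>sqrt l - \<alpha>\<close> on the spectrum of \<open>A\<close>.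
  At \<open>l = threshold\<close> it vanishes, as does the finite-rank symbol, so that eigenspace
  may be infinite-dimensional.\<close>

definition compact_symbol :: "real \<Rightarrow> real" where
  "compact_symbol l = (if l < threshold then 0 else sqrt l - \<alpha>)"

definition finite_rank_symbol :: "real \<Rightarrow> real" where
  "finite_rank_symbol l = (if l < threshold then \<alpha> - sqrt l else 0)"

lemma \<alpha>_nonneg: "0 \<le> \<alpha>"
  by (simp add: \<alpha>_def threshold_nonneg)

lemma compact_symbol_nonneg: "0 \<le> compact_symbol l"
  by (simp add: compact_symbol_def \<alpha>_def)

lemma finite_rank_symbol_bounds: "0 \<le> finite_rank_symbol l" "0 \<le> l \<Longrightarrow> finite_rank_symbol l \<le> \<alpha>"
  by (auto simp: finite_rank_symbol_def \<alpha>_def threshold_nonneg)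

lemma bounded_compact_symbol: "bounded_symbol compact_symbol (onorm T)"
proof -
  have "\<bar>compact_symbol l\<bar> \<le> \<bar>sqrt l\<bar>" for l
    using threshold_nonneg by (auto simp: compact_symbol_def \<alpha>_def)
  with bounded_symbol_sqrt show ?thesis
    unfolding bounded_symbol_def by (meson order_trans)
qed

lemma bounded_finite_rank_symbol: "bounded_symbol finite_rank_symbol \<alpha>"
  using finite_rank_symbol_bounds \<alpha>_nonneg by (intro bounded_symbolI) auto

definition K :: "'a \<Rightarrow> 'a" where
  "K = V \<circ> diag_op compact_symbol"

definition F :: "'a \<Rightarrow> 'a" where
  "F = V \<circ> diag_op finite_rank_symbol"

lemma bounded_linear_K: "bounded_linear K"
  unfolding K_def by (intro bounded_clinear_bounded_linear bounded_clinear_V_diag_op[OF bounded_compact_symbol])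

lemma bounded_linear_F: "bounded_linear F"
  unfolding F_def by (intro bounded_clinear_bounded_linear bounded_clinear_V_diag_op[OF bounded_finite_rank_symbol])

lemma K_E: "e \<in> E l \<Longrightarrow> K e = compact_symbol l *\<^sub>R V e"
  using bounded_linear_V by (simp add: K_def diag_op_E linear_simps)

lemma F_E: "e \<in> E l \<Longrightarrow> F e = finite_rank_symbol l *\<^sub>R V e"
  using bounded_linear_V by (simp add: F_def diag_op_E linear_simps)

lemma T_decomposition: "T = (\<lambda>x. K x - F x + \<alpha> *\<^sub>R V x)"
proof (rule ext_E_nonneg[OF bounded_linear_T])
  show "bounded_linear (\<lambda>x. K x - F x + \<alpha> *\<^sub>R V x)"
    by (intro bounded_linear_add bounded_linear_sub bounded_linear_const_scaleR
        bounded_linear_K bounded_linear_F bounded_linear_V)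
  show "T e = K e - F e + \<alpha> *\<^sub>R V e" if e: "e \<in> E l" "0 \<le> l" for l e
  proof -
    have "K e - F e + \<alpha> *\<^sub>R V e = (compact_symbol l - finite_rank_symbol l + \<alpha>) *\<^sub>R V e"
      by (simp add: K_E[OF e(1)] F_E[OF e(1)] algebra_simps)
    also have "compact_symbol l - finite_rank_symbol l + \<alpha> = sqrt l"
      by (simp add: compact_symbol_def finite_rank_symbol_def)
    also have "sqrt l *\<^sub>R V e = T e"
      using norm_T_E[OF e(1)] by (cases "l = 0") (simp_all add: V_E[OF e])
    finally show ?thesis
      by simp
  qed
qed

text \<open>The symbols have disjoint supports, and the inner \<open>V\<close> keeps an eigenvector
  in \<open>E l\<close>, so both factors see the same \<open>l\<close>. Both orders are computed
  because \<open>K\<close> and \<open>F\<close> must commute.\<close>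

lemma
  shows K_F: "K \<circ> F = (\<lambda>x. 0)"
    and F_K: "F \<circ> K = (\<lambda>x. 0)"
proof -
  have KF: "compact_symbol l = 0 \<or> finite_rank_symbol l = 0" for l
    by (simp add: compact_symbol_def finite_rank_symbol_def)
  show "K \<circ> F = (\<lambda>x. 0)"
  proof (rule ext_E_nonneg)
    show "bounded_linear (K \<circ> F)"
      unfolding comp_def by (rule bounded_linear_compose[OF bounded_linear_K bounded_linear_F])
    show "(K \<circ> F) e = 0" if "e \<in> E l" "0 \<le> l" for l e
      using that KF[of l] by (auto simp: F_E K_E[OF scaleR_in_E[OF V_in_E]] linear_simps[OF bounded_linear_V])
  qed (rule bounded_linear_zero)
  show "F \<circ> K = (\<lambda>x. 0)"
  proof (rule ext_E_nonneg)
    show "bounded_linear (F \<circ> K)"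
      unfolding comp_def by (rule bounded_linear_compose[OF bounded_linear_F bounded_linear_K])
    show "(F \<circ> K) e = 0" if "e \<in> E l" "0 \<le> l" for l e
      using that KF[of l] by (auto simp: K_E F_E[OF scaleR_in_E[OF V_in_E]] linear_simps[OF bounded_linear_V])
  qed (rule bounded_linear_zero)
qed

lemma adj_F_F_le: "op_le (cadjoint F \<circ> F) (\<lambda>x. \<alpha>\<^sup>2 *\<^sub>R x)"
proof -
  define \<psi> where "\<psi> l = (finite_rank_symbol l)\<^sup>2 * support_symbol l" for l
  have \<psi>: "bounded_symbol \<psi> (\<alpha>\<^sup>2)"
    unfolding \<psi>_def by (rule bounded_symbol_power2_support[OF bounded_finite_rank_symbol])
  have FF: "cadjoint F \<circ> F = diag_op \<psi>"
    unfolding F_def \<psi>_def by (rule adj_V_diag_op[OF bounded_finite_rank_symbol])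
  have const: "bounded_symbol (\<lambda>l. \<alpha>\<^sup>2) (\<alpha>\<^sup>2)"
    by (rule bounded_symbolI) auto
  have lin: "bounded_linear (\<lambda>x. \<alpha>\<^sup>2 *\<^sub>R (x :: 'a))"
    by (rule bounded_linear_scaleR_right)
  have I: "(\<lambda>x. \<alpha>\<^sup>2 *\<^sub>R x) = diag_op (\<lambda>l. \<alpha>\<^sup>2)"
    by (rule diag_op_eq[OF const lin]) simp
  have \<psi>_bounds: "0 \<le> \<psi> l" "0 \<le> l \<Longrightarrow> \<psi> l \<le> \<alpha>\<^sup>2" for l
    using finite_rank_symbol_bounds[of l] by (auto simp: \<psi>_def support_symbol_def power_mono)
  have diff: "bounded_symbol (\<lambda>l. \<alpha>\<^sup>2 - \<psi> l) (\<alpha>\<^sup>2)"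
    using \<psi>_bounds by (intro bounded_symbolI) auto
  have "(\<lambda>x. \<alpha>\<^sup>2 *\<^sub>R x - (cadjoint F \<circ> F) x) = diag_op (\<lambda>l. \<alpha>\<^sup>2 - \<psi> l)"
  proof (rule diag_op_eq[OF diff])
    show "bounded_linear (\<lambda>x. \<alpha>\<^sup>2 *\<^sub>R x - (cadjoint F \<circ> F) x)"
      unfolding FF by (intro bounded_linear_sub lin bounded_linear_diag_op[OF \<psi>])
  qed (simp only: FF diag_op_E scaleR_diff_left)
  then show ?thesis
    unfolding op_le_def using FF I positive_diag_op[OF diff] \<psi>_bounds
      self_adjoint_diag_op[OF \<psi>] self_adjoint_diag_op[OF const] by simp
qed

text \<open>\<open>V* K\<close> is diagonal with a real symbol, so it equals its own real part; the
  whole expression then has a nonnegative symbol.\<close>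

lemma positive_K:
  "positive_op (\<lambda>x. (cadjoint K \<circ> K) x + (2 * \<alpha>) *\<^sub>R op_Re (cadjoint V \<circ> K) x)"
proof -
  have KK: "cadjoint K \<circ> K = diag_op (\<lambda>l. (compact_symbol l)\<^sup>2 * support_symbol l)"
    unfolding K_def by (rule adj_V_diag_op[OF bounded_compact_symbol])
  note sym1 = bounded_symbol_power2_support[OF bounded_compact_symbol]
  have sym2: "bounded_symbol (\<lambda>l. compact_symbol l * support_symbol l) (onorm T)"
    using bounded_compact_symbol by (auto simp: bounded_symbol_def support_symbol_def)
  have sym: "bounded_symbol (\<lambda>l. (compact_symbol l)\<^sup>2 * support_symbol l + 2 * \<alpha> * (compact_symbol l * support_symbol l))
      ((onorm T)\<^sup>2 + 2 * \<alpha> * onorm T)"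
    using sym1 sym2 \<alpha>_nonneg unfolding bounded_symbol_def
    by (auto intro!: order_trans[OF abs_triangle_ineq] add_mono simp: abs_mult intro!: mult_left_mono)
  have VK: "cadjoint V \<circ> K = diag_op (\<lambda>l. compact_symbol l * support_symbol l)"
  proof (rule diag_op_eq_nonneg[OF sym2])
    show "bounded_linear (cadjoint V \<circ> K)"
      unfolding comp_def by (rule bounded_linear_compose[OF bounded_linear_V_adj bounded_linear_K])
  qed (simp add: K_E V_adj_V_E linear_simps[OF bounded_linear_V_adj])
  have Re: "op_Re (cadjoint V \<circ> K) = diag_op (\<lambda>l. compact_symbol l * support_symbol l)"
    using self_adjoint_diag_op[OF sym2] unfolding VK op_Re_def
    by (simp add: self_adjoint_op_def fun_eq_iff flip: scaleR_2)
  have "(\<lambda>x. (cadjoint K \<circ> K) x + (2 * \<alpha>) *\<^sub>R op_Re (cadjoint V \<circ> K) x) =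
      diag_op (\<lambda>l. (compact_symbol l)\<^sup>2 * support_symbol l + 2 * \<alpha> * (compact_symbol l * support_symbol l))"
  proof (rule diag_op_eq[OF sym])
    show "bounded_linear (\<lambda>x. (cadjoint K \<circ> K) x + (2 * \<alpha>) *\<^sub>R op_Re (cadjoint V \<circ> K) x)"
      unfolding KK Re
      by (intro bounded_linear_add bounded_linear_const_scaleR bounded_linear_diag_op[OF sym1]
          bounded_linear_diag_op[OF sym2])
  qed (simp add: KK Re diag_op_E scaleR_add_left del: comp_apply)
  then show ?thesis
    using positive_diag_op[OF sym] compact_symbol_nonneg \<alpha>_nonneg by (simp add: support_symbol_def)
qed

lemma commute_V: "V \<circ> K = K \<circ> V" "V \<circ> F = F \<circ> V"
  unfolding K_def F_def
  using diag_op_commutes_V[OF bounded_compact_symbol] diag_op_commutes_V[OF bounded_finite_rank_symbol]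
  by (simp_all add: comp_assoc)

section \<open>Finite rank, compactness and norm attainment\<close>

lemma finite_rank_F: "finite_rank_op F"
proof -
  obtain B where B: "finite B"
      "\<And>l e. l \<in> {..<threshold} \<Longrightarrow> e \<in> E l \<Longrightarrow> e = (\<Sum>b\<in>B. cinner e b *\<^sub>C b)"
    using spectral_finite_basis[OF spectral_finite_below_threshold] by metis
  have "diag_op finite_rank_symbol x \<in> cspan B" for x
  proof -
    have "diag_op finite_rank_symbol x = (\<Sum>b\<in>B. cinner (diag_op finite_rank_symbol x) b *\<^sub>C b)"
      by (rule diag_op_finite_expansion[where S = "{..<threshold}", OF bounded_finite_rank_symbol B])
        (simp_all add: finite_rank_symbol_def)
    also have "\<dots> \<in> cspan B"
      by (intro complex_vector.span_sum complex_vector.span_scale complex_vector.span_base)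
    finally show ?thesis .
  qed
  \<comment> \<open>Commuting \<open>V\<close> to the right places the range of \<open>F\<close>
    inside that of the diagonal factor.\<close>
  then have "range F \<subseteq> cspan B"
    unfolding F_def diag_op_commutes_V[OF bounded_finite_rank_symbol, symmetric] by auto
  then show ?thesis
    using B(1) bounded_clinear_V_diag_op[OF bounded_finite_rank_symbol]
    by (intro finite_rank_opI) (simp_all add: F_def)
qed

lemma compact_K: "compact_op K"
  unfolding K_def
proof (intro compact_op_comp bounded_clinear_V compact_op_if_finite_rank_approx)
  show "bounded_clinear (diag_op compact_symbol)"
    by (rule bounded_clinear_diag_op[OF bounded_compact_symbol])
  fix \<epsilon> :: real assume \<epsilon>: "\<epsilon> > 0"
  \<comment> \<open>Chosen so that \<open>sqrt l - \<alpha> \<le> \<epsilon>\<close> for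
    \<open>l \<le> s\<close>: cutting the symbol off at \<open>s\<close> costs at most \<epsilon> in
    norm, and since \<open>s\<close> exceeds \<open>threshold\<close>, only finitely many dimensions
    remain above it.\<close>
  define s where "s = (\<alpha> + \<epsilon>)\<^sup>2"
  have sqrt_s: "sqrt s = \<alpha> + \<epsilon>"
    using \<alpha>_nonneg \<epsilon> by (simp add: s_def)
  then have "threshold < s"
    using \<epsilon> unfolding \<alpha>_def by (metis less_add_same_cancel1 real_sqrt_less_iff)
  then obtain B where B: "finite B" "orthonormal_set B"
      "\<And>l e. l \<in> {s<..} \<Longrightarrow> e \<in> E l \<Longrightarrow> e = (\<Sum>b\<in>B. cinner e b *\<^sub>C b)"
    using spectral_finite_basis[OF spectral_finite_above_threshold] by metis
  define \<psi> where "\<psi> l = (if s < l then compact_symbol l else 0)" for l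
  have \<psi>: "bounded_symbol \<psi> (onorm T)"
    using bounded_compact_symbol by (auto simp: bounded_symbol_def \<psi>_def)
  have rest: "bounded_symbol (\<lambda>l. compact_symbol l - \<psi> l) \<epsilon>"
  proof (rule bounded_symbolI)
    fix l :: real assume "0 \<le> l"
    have "compact_symbol l \<le> \<epsilon>" if "l \<le> s"
    proof -
      have "sqrt l \<le> \<alpha> + \<epsilon>"
        using that by (simp flip: sqrt_s)
      with \<epsilon> show ?thesis
        by (simp add: compact_symbol_def)
    qed
    then show "\<bar>compact_symbol l - \<psi> l\<bar> \<le> \<epsilon>"
      using \<epsilon> compact_symbol_nonneg[of l] by (auto simp: \<psi>_def)
  qed (use \<epsilon> in simp)
  have "(\<lambda>x. diag_op compact_symbol x - diag_op \<psi> x) = diag_op (\<lambda>l. compact_symbol l - \<psi> l)"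
  proof (rule diag_op_eq[OF rest])
    show "bounded_linear (\<lambda>x. diag_op compact_symbol x - diag_op \<psi> x)"
      by (intro bounded_linear_sub bounded_linear_diag_op[OF \<psi>] bounded_linear_diag_op[OF bounded_compact_symbol])
  qed (simp add: diag_op_E scaleR_diff_left)
  then have "norm (diag_op compact_symbol x - diag_op \<psi> x) \<le> \<epsilon> * norm x" for x
    using norm_diag_op[OF rest, of x] by metis
  moreover have "diag_op \<psi> x = (\<Sum>b\<in>B. cinner (diag_op \<psi> x) b *\<^sub>C b)" for x
    by (rule diag_op_finite_expansion[where S = "{s<..}", OF \<psi> B(1,3)]) (simp_all add: \<psi>_def)
  ultimately show "\<exists>G B. bounded_linear G \<and> finite B \<and> orthonormal_set B \<and>
      (\<forall>x. G x = (\<Sum>b\<in>B. cinner (G x) b *\<^sub>C b)) \<and> (\<forall>x. norm (diag_op compact_symbol x - G x) \<le> \<epsilon> * norm x)"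
    using B(1,2) bounded_linear_diag_op[OF \<psi>] by blast
qed

text \<open>The null space of \<open>V\<close> is \<open>E 0\<close>, which lies below the positive
  threshold and so in the span of the finite set \<open>B\<close>. Vectors orthogonal to
  \<open>B\<close> are therefore orthogonal to the null space, where a partial isometry preserves
  norms.\<close>

lemma absolutely_norm_attaining_V:
  assumes "\<alpha> > 0"
  shows "absolutely_norm_attaining V"
proof -
  have "0 < threshold"
    using assms by (simp add: \<alpha>_def)
  obtain B where B: "finite B" "orthonormal_set B"
      "\<And>l e. l \<in> {..<threshold} \<Longrightarrow> e \<in> E l \<Longrightarrow> e = (\<Sum>b\<in>B. cinner e b *\<^sub>C b)"
    using spectral_finite_basis[OF spectral_finite_below_threshold] by metis
  show ?thesis
  proof (rule absolutely_norm_attaining_if_isometric_on_finite_codim[OF bounded_clinear_V _ B(1,2)])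
    have sym: "bounded_symbol support_symbol 1"
      by (rule bounded_symbolI) (auto simp: support_symbol_def)
    have "cadjoint V \<circ> V = diag_op support_symbol"
    proof (rule diag_op_eq_nonneg[OF sym])
      show "bounded_linear (cadjoint V \<circ> V)"
        unfolding comp_def by (rule bounded_linear_compose[OF bounded_linear_V_adj bounded_linear_V])
    qed (simp add: V_adj_V_E)
    then have VV: "cadjoint V (V x) = diag_op support_symbol x" for x
      by (metis comp_apply)
    show "norm (V x) \<le> norm x" for x
    proof -
      have "(norm (V x))\<^sup>2 = inner x (diag_op support_symbol x)"
        by (simp add: power2_norm_eq_inner inner_eq_Re_cinner cinner_cadjoint[OF bounded_clinear_V] flip: VV)
      also have "\<dots> \<le> norm x * norm (diag_op support_symbol x)"
        by (rule norm_cauchy_schwarz)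
      also have "\<dots> \<le> norm x * norm x"
        using norm_diag_op[OF sym, of x] by (intro mult_left_mono) auto
      finally show ?thesis
        by (simp add: power2_eq_square abs_le_square_iff[symmetric] flip: power2_eq_square)
    qed
    show "norm (V x) = norm x" if orth: "\<And>b. b \<in> B \<Longrightarrow> cinner x b = 0" for x
    proof -
      have "cinner x y = 0" if "y \<in> null_space V" for y
      proof -
        have "T y = 0"
          using that polar by (auto simp: polar_decomposition_def null_space_def)
        then have "y \<in> E 0"
          using bounded_linear_T_adj by (simp add: E_def A_def linear_simps)
        then have y: "y = (\<Sum>b\<in>B. cinner y b *\<^sub>C b)"
          using B(3) \<open>0 < threshold\<close> by simp
        have "cinner y x = (\<Sum>b\<in>B. cinner y b * cinner b x)"
          by (subst y) (simp add: cinner_sum_left cinner_scaleC_left)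
        also have "\<dots> = 0"
          using orth by (intro sum.neutral) (metis cinner_commute complex_cnj_zero mult_zero_right)
        finally show ?thesis
          by (metis cinner_commute complex_cnj_zero)
      qed
      then show ?thesis
        using polar by (simp add: polar_decomposition_def partial_isometry_def)
    qed
  qed
qed

end

theorem proposition3p5:
  fixes T V :: "'a::chilbert_space \<Rightarrow> 'a"
  assumes "absolutely_norm_attaining T"
    and "normal_op T"
    and "polar_decomposition T V"
  shows "\<exists>(K :: 'a \<Rightarrow> 'a) (F :: 'a \<Rightarrow> 'a) (\<alpha> :: real).
    compact_op K \<and> normal_op K \<and> finite_rank_op F \<and> normal_op F \<and> \<alpha> \<ge> 0 \<and>
    (T = (\<lambda>x. K x - F x + \<alpha> *\<^sub>R V x) \<and> K \<circ> F = (\<lambda>x. 0) \<and>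
      op_le (cadjoint F \<circ> F) (\<lambda>x. \<alpha>\<^sup>2 *\<^sub>R x)) \<and>
    positive_op (\<lambda>x. (cadjoint K \<circ> K) x + (2 * \<alpha>) *\<^sub>R op_Re (cadjoint V \<circ> K) x) \<and>
    (V \<circ> K = K \<circ> V \<and> V \<circ> F = F \<circ> V \<and> K \<circ> F = F \<circ> K) \<and>
    (\<alpha> > 0 \<longrightarrow> absolutely_norm_attaining V)"
proof -
  interpret normal_an_operator T V
    by unfold_locales (use assms in blast)+
  have "normal_op K" "normal_op F"
    unfolding K_def F_def
    by (rule normal_op_V_diag_op[OF bounded_compact_symbol], rule normal_op_V_diag_op[OF bounded_finite_rank_symbol])
  then show ?thesis
    using compact_K finite_rank_F \<alpha>_nonneg T_decomposition K_F F_K adj_F_F_le positive_K commute_V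
      absolutely_norm_attaining_V
    by (intro exI[of _ K] exI[of _ F] exI[of _ \<alpha>]) simp
qed

end
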